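(* Let $A$ and $B$ be skew shapes. If $\operatorname{supp}(A)\supseteq\operatorname{supp}(B)$, then $\mathrm{rows}_k(A)\trianglelefteq\mathrm{rows}_k(B)$ for all $k\ge1$.
   Context: A skew shape $\lambda/\mu$ is the set of boxes of the Young diagram of $\lambda$ (English notation) not in that of $\mu\subseteq\lambda$. The skew Schur function is $s_A=\sum_T x^T$ over semistandard Young tableaux $T$ of shape $A$ (entries weakly increasing along rows, strictly increasing down columns), $x^T=\prod_i x_i^{\#\{i\text{'s in }T\}}$. The support $\operatorname{supp}(A)$ is the set of partitions $\nu$ such that the Schur function $s_\nu$ has nonzero coefficient in the expansion of $s_A$ in the Schur basis. For a skew shape $A$ with $r$ rows (numbered top to bottom) and $k\ge1$, for $i=1,\ldots,r-k+1$ let $\mathrm{ov}_k(i)$ be the number of columns occupied in common by rows $i,\ldots,i+k-1$; $\mathrm{rows}_k(A)$ is the weakly decreasing rearrangement of these numbers, as a partition (zeros discarded; empty if $k>r$). For partitions $\lambda=(\lambda_1,\ldots,\lambda_r)$, $\mu$ (with trailing zeros), $\lambda\trianglelefteq\mu$ means $\lambda_1+\cdots+\lambda_j\le\mu_1+\cdots+\mu_j$ for all $j=1,\ldots,r$; sizes need not be equal. *)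

theory Defs
  imports Main "HOL-Library.FuncSet" "HOL-Library.Poly_Mapping"
begin

text \<open>Partitions are weakly decreasing lists of positive integers. Boxes are pairs (row, column)
  with both coordinates starting at 1, rows numbered from top to bottom.\<close>

definition is_partition :: "nat list \<Rightarrow> bool" where
  "is_partition la \<longleftrightarrow> sorted_wrt (\<ge>) la \<and> 0 \<notin> set la"

definition diagram :: "nat list \<Rightarrow> (nat \<times> nat) set" where
  "diagram la = {(i, j). 1 \<le> i \<and> i \<le> length la \<and> 1 \<le> j \<and> j \<le> la ! (i - 1)}"

definition skew_shape :: "(nat \<times> nat) set \<Rightarrow> bool" where
  "skew_shape A \<longleftrightarrow>
     (\<exists>la mu. is_partition la \<and> is_partition mu \<and> diagram mu \<subseteq> diagram la \<and> A = diagram la - diagram mu)"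

text \<open>Fillings are extensional functions, so that each tableau of shape \<open>A\<close> is counted once below.\<close>

definition ssyt :: "(nat \<times> nat) set \<Rightarrow> (nat \<times> nat \<Rightarrow> nat) set" where
  "ssyt A = {T \<in> A \<rightarrow>\<^sub>E {1..}.
     (\<forall>i j j'. (i, j) \<in> A \<and> (i, j') \<in> A \<and> j < j' \<longrightarrow> T (i, j) \<le> T (i, j')) \<and>
     (\<forall>i i' j. (i, j) \<in> A \<and> (i', j) \<in> A \<and> i < i' \<longrightarrow> T (i, j) < T (i', j))}"

text \<open>A formal power series in \<open>x\<^sub>1, x\<^sub>2, \<dots>\<close> is given by its coefficients; a monomial is its finitely
  supported exponent vector, written additively. The monomial of \<open>T\<close> is thus the product over all
  boxes \<open>b\<close> of the variable with index \<open>T b\<close>.\<close>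

type_synonym monomial = "nat \<Rightarrow>\<^sub>0 nat"
type_synonym power_series = "monomial \<Rightarrow> int"

definition tableau_monomial :: "(nat \<times> nat) set \<Rightarrow> (nat \<times> nat \<Rightarrow> nat) \<Rightarrow> monomial" where
  "tableau_monomial A T = (\<Sum>b\<in>A. Poly_Mapping.single (T b) 1)"

definition skew_schur :: "(nat \<times> nat) set \<Rightarrow> power_series" where
  "skew_schur A = (\<lambda>m. int (card {T \<in> ssyt A. tableau_monomial A T = m}))"

definition schur :: "nat list \<Rightarrow> power_series" where
  "schur nu = skew_schur (diagram nu)"

definition is_schur_expansion :: "power_series \<Rightarrow> (nat list \<Rightarrow>\<^sub>0 int) \<Rightarrow> bool" where
  "is_schur_expansion f c \<longleftrightarrow>
     (\<forall>nu \<in> Poly_Mapping.keys c. is_partition nu) \<and>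
     f = (\<lambda>m. \<Sum>nu \<in> Poly_Mapping.keys c. Poly_Mapping.lookup c nu * schur nu m)"

text \<open>Existence and uniqueness of the expansion of a skew Schur function (the Schur functions form a
  basis of the ring of symmetric functions) are mathematical facts, not part of the definition.\<close>

definition schur_expansion :: "power_series \<Rightarrow> (nat list \<Rightarrow>\<^sub>0 int)" where
  "schur_expansion f = (THE c. is_schur_expansion f c)"

definition supp :: "(nat \<times> nat) set \<Rightarrow> nat list set" where
  "supp A = {nu. is_partition nu \<and> Poly_Mapping.lookup (schur_expansion (skew_schur A)) nu \<noteq> 0}"

text \<open>Rows are counted up to the last nonempty one. Empty rows of \<open>la/mu\<close> above it are counted too,
  but this does not affect the overlap partitions: no column meets rows on both sides of an empty
  row, so keeping or deleting it only changes the number of zero overlaps, which are discarded.\<close>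

definition num_rows :: "(nat \<times> nat) set \<Rightarrow> nat" where
  "num_rows A = Max (insert 0 (fst ` A))"

definition overlap :: "nat \<Rightarrow> (nat \<times> nat) set \<Rightarrow> nat \<Rightarrow> nat" where
  "overlap k A i = card {j. \<forall>t \<in> {i..<i + k}. (t, j) \<in> A}"

text \<open>The index list is \<open>1, \<dots>, r - k + 1\<close>; it is empty if \<open>k > r\<close>, also under truncated subtraction.\<close>

definition rows :: "nat \<Rightarrow> (nat \<times> nat) set \<Rightarrow> nat list" where
  "rows k A = rev (sort (filter (\<lambda>n. n \<noteq> 0) (map (overlap k A) [1..<num_rows A + 2 - k])))"

text \<open>\<open>take\<close> past the end of a list amounts to padding with zeros; sizes need not agree.\<close>

definition dominated :: "nat list \<Rightarrow> nat list \<Rightarrow> bool"  (infix "\<unlhd>" 50) where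
  "la \<unlhd> mu \<longleftrightarrow> (\<forall>j \<in> {1..length la}. sum_list (take j la) \<le> sum_list (take j mu))"

end

(* By the Littlewood--Richardson rule, proved below with Stembridge's sign-reversing involution, the
   support of A consists of the contents of the lattice fillings of A. In a lattice filling of A with
   content nu, the entries >= k of any l rows number at most nu_k + ... + nu_(k+l-1), and the last of
   k consecutive rows has an entry >= k in each column common to them; this bounds the l largest k-overlaps
   of A. Conversely B has a lattice filling, given by 1, ..., k - 1 at the top of each column and a key
   filling of the remaining skew shape, whose content nu has nu_k + ... + nu_(k+l-1) at most the sum of
   the l largest k-overlaps of B. Comparing the two for this nu gives the claim. *)

theory Submission
  imports Defs "HOL-Combinatorics.Permutations"
begin

text \<open>The support is defined through a definite description, so Schur expansions must be shown
  to exist and to be unique before any combinatorics applies. Both come from the functionals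
  \<open>alt_coeff N nu\<close>, which send Schur functions to 0 or 1: uniqueness because they read
  off coefficients, existence because a symmetric series with bounded exponents that all of them
  kill is zero. On a skew Schur function the same functional counts lattice fillings. On the
  combinatorial side one filling of \<open>B\<close> has to meet the bounds for every
  \<open>l\<close> at once. A key filling does: its content is the decreasing rearrangement of the
  row lengths. It is taken on the shape left after stripping up to \<open>k - 1\<close> boxes from
  the top of each column, whose row lengths are the \<open>k\<close>-overlaps of \<open>B\<close>.
  That shape arises without a presenting pair of partitions; hence the arguments run on finite sets
  of boxes that are convex in the componentwise order.\<close>

section \<open>Convex shapes, tableaux and their contents\<close>

definition convex_shape :: "(nat \<times> nat) set \<Rightarrow> bool" where
  "convex_shape A \<longleftrightarrow> finite A \<and> (\<forall>i j. (i, j) \<in> A \<longrightarrow> 1 \<le> i \<and> 1 \<le> j) \<and>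
     (\<forall>i j i' j' a b. (i, j) \<in> A \<and> (i', j') \<in> A \<and> i \<le> a \<and> a \<le> i' \<and> j \<le> b \<and> b \<le> j' \<longrightarrow> (a, b) \<in> A)"

text \<open>Indexed from 1 and padded with zeros. Index 0 also gets 0, matching tableaux with
  entries at least 1, so that contents can be compared at every natural number.\<close>

definition part :: "nat list \<Rightarrow> nat \<Rightarrow> nat" where
  "part nu i = (if 1 \<le> i \<and> i \<le> length nu then nu ! (i - 1) else 0)"

definition cnt :: "(nat \<times> nat) set \<Rightarrow> (nat \<times> nat \<Rightarrow> nat) \<Rightarrow> nat \<Rightarrow> nat" where
  "cnt A T v = card {b \<in> A. T b = v}"

definition col_cnt :: "(nat \<times> nat) set \<Rightarrow> (nat \<times> nat \<Rightarrow> nat) \<Rightarrow> nat \<Rightarrow> nat \<Rightarrow> nat" where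
  "col_cnt A T c v = card {b \<in> A. c \<le> snd b \<and> T b = v}"

text \<open>The lattice word condition for reading the columns from right to left, each downwards.
  Cuts between whole columns suffice for tableaux: inside a column \<open>v\<close> is read before
  \<open>v + 1\<close>, so no inner cut is worse.\<close>

definition lattice_filling :: "(nat \<times> nat) set \<Rightarrow> (nat \<times> nat \<Rightarrow> nat) \<Rightarrow> bool" where
  "lattice_filling A T \<longleftrightarrow> (\<forall>c. \<forall>v\<ge>1. col_cnt A T c (Suc v) \<le> col_cnt A T c v)"

definition LR :: "(nat \<times> nat) set \<Rightarrow> nat list \<Rightarrow> (nat \<times> nat \<Rightarrow> nat) set" where
  "LR A nu = {T \<in> ssyt A. (\<forall>v. cnt A T v = part nu v) \<and> lattice_filling A T}"

lemma convex_shapeD: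
  assumes "convex_shape A"
  shows "finite A" "(i, j) \<in> A \<Longrightarrow> 1 \<le> i" "(i, j) \<in> A \<Longrightarrow> 1 \<le> j"
    "(i, j) \<in> A \<Longrightarrow> (i', j') \<in> A \<Longrightarrow> i \<le> a \<Longrightarrow> a \<le> i' \<Longrightarrow> j \<le> b \<Longrightarrow> b \<le> j' \<Longrightarrow> (a, b) \<in> A"
  using assms unfolding convex_shape_def by blast+

lemma part_mono:
  assumes "is_partition nu" "1 \<le> i" "i \<le> i'"
  shows "part nu i' \<le> part nu i"
proof (cases "i' \<le> length nu \<and> i < i'")
  case True
  then have "nu ! (i - 1) \<ge> nu ! (i' - 1)"
    using assms sorted_wrt_nth_less[of "(\<ge>)" nu "i - 1" "i' - 1"] unfolding is_partition_def by auto
  then show ?thesis using True assms by (auto simp: part_def)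
qed (use assms in \<open>auto simp: part_def le_less\<close>)

lemma mem_diagram: "(i, j) \<in> diagram la \<longleftrightarrow> 1 \<le> j \<and> j \<le> part la i"
  by (auto simp: diagram_def part_def)

lemma finite_diagram: "finite (diagram la)"
proof -
  have "diagram la \<subseteq> (SIGMA i:{1..length la}. {1..part la i})"
    by (auto simp: diagram_def part_def)
  then show ?thesis by (rule finite_subset) auto
qed

lemma skew_shape_convex:
  assumes "skew_shape A" shows "convex_shape A"
proof -
  obtain la mu where *: "is_partition la" "is_partition mu" "A = diagram la - diagram mu"
    using assms unfolding skew_shape_def by blast
  have "(a, b) \<in> A" if "(i, j) \<in> A" "(i', j') \<in> A" "i \<le> a" "a \<le> i'" "j \<le> b" "b \<le> j'" for i j i' j' a b
  proof -
    have i: "1 \<le> i" "1 \<le> j" using that(1) *(3) by (auto simp: diagram_def)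
    have "part la i' \<le> part la a" using part_mono[OF *(1), of a i'] i that by simp
    moreover have "part mu a \<le> part mu i" using part_mono[OF *(2), of i a] i that by simp
    ultimately show ?thesis using that i unfolding *(3) by (auto simp: mem_diagram)
  qed
  moreover have "finite A" using finite_diagram *(3) by auto
  moreover have "\<forall>i j. (i, j) \<in> A \<longrightarrow> 1 \<le> i \<and> 1 \<le> j" using *(3) by (auto simp: diagram_def)
  ultimately show ?thesis unfolding convex_shape_def by blast
qed

lemma diagram_convex: "is_partition la \<Longrightarrow> convex_shape (diagram la)"
  by (rule skew_shape_convex, unfold skew_shape_def, rule exI[of _ la], rule exI[of _ "[]"])
    (auto simp: is_partition_def diagram_def)

lemma ssytD:
  assumes "T \<in> ssyt A"
  shows "(i, j) \<in> A \<Longrightarrow> (i, j') \<in> A \<Longrightarrow> j \<le> j' \<Longrightarrow> T (i, j) \<le> T (i, j')"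
    "(i, j) \<in> A \<Longrightarrow> (i', j) \<in> A \<Longrightarrow> i < i' \<Longrightarrow> T (i, j) < T (i', j)"
    "b \<in> A \<Longrightarrow> 1 \<le> T b" "b \<notin> A \<Longrightarrow> T b = undefined"
proof -
  have T: "T \<in> A \<rightarrow>\<^sub>E {1..}"
    and row: "\<And>i j j'. (i, j) \<in> A \<Longrightarrow> (i, j') \<in> A \<Longrightarrow> j < j' \<Longrightarrow> T (i, j) \<le> T (i, j')"
    and col: "\<And>i i' j. (i, j) \<in> A \<Longrightarrow> (i', j) \<in> A \<Longrightarrow> i < i' \<Longrightarrow> T (i, j) < T (i', j)"
    using assms unfolding ssyt_def by blast+
  show "(i, j) \<in> A \<Longrightarrow> (i, j') \<in> A \<Longrightarrow> j \<le> j' \<Longrightarrow> T (i, j) \<le> T (i, j')"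
    using row[of i j j'] by (cases "j = j'") auto
  show "(i, j) \<in> A \<Longrightarrow> (i', j) \<in> A \<Longrightarrow> i < i' \<Longrightarrow> T (i, j) < T (i', j)" by (rule col)
  show "b \<in> A \<Longrightarrow> 1 \<le> T b" using PiE_mem[OF T] by auto
  show "b \<notin> A \<Longrightarrow> T b = undefined" using PiE_arb[OF T] .
qed

lemma ssyt_column_inj:
  assumes "T \<in> ssyt A" "(i, j) \<in> A" "(i', j) \<in> A" "T (i, j) = T (i', j)"
  shows "i = i'"
  using ssytD(2)[OF assms(1)] assms(2-4) by (metis nat_neq_iff)

text \<open>Go right in row \<open>i\<close> to column \<open>j'\<close>, then down. Convexity keeps
  this path inside \<open>A\<close>, and each downward step raises the entry by at least
  one.\<close>

lemma ssyt_weak_mono: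
  assumes "convex_shape A" "T \<in> ssyt A" "(i, j) \<in> A" "(i', j') \<in> A" "i \<le> i'" "j \<le> j'"
  shows "T (i, j) + (i' - i) \<le> T (i', j')"
  using assms(4,5)
proof (induction "i' - i" arbitrary: i')
  case 0
  then show ?case using ssytD(1)[OF assms(2,3)] assms(6) by simp
next
  case (Suc n)
  define i'' where "i'' = i' - 1"
  have i: "i' = Suc i''" "i \<le> i''" using Suc.hyps(2) by (auto simp: i''_def)
  have "(i'', j') \<in> A" using convex_shapeD(4)[OF assms(1,3) Suc.prems(1)] i assms(6) by auto
  with Suc.hyps(1)[of i''] Suc.hyps(2) i have "T (i, j) + (i'' - i) \<le> T (i'', j')" by auto
  moreover have "T (i'', j') < T (i', j')" using ssytD(2)[OF assms(2) \<open>(i'', j') \<in> A\<close> Suc.prems(1)] i by simp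
  ultimately show ?case using i by simp
qed

lemma lookup_tableau_monomial:
  assumes "finite A"
  shows "Poly_Mapping.lookup (tableau_monomial A T) v = cnt A T v"
proof -
  have "Poly_Mapping.lookup (tableau_monomial A T) v = (\<Sum>b\<in>A. if T b = v then 1 else 0)"
    unfolding tableau_monomial_def lookup_sum by (rule sum.cong) (auto simp: lookup_single when_def)
  also have "\<dots> = cnt A T v" using assms by (simp add: cnt_def sum.If_cases Int_def)
  finally show ?thesis .
qed

lemma tableau_monomial_eq_iff:
  "finite A \<Longrightarrow> tableau_monomial A T = m \<longleftrightarrow> (\<forall>v. cnt A T v = Poly_Mapping.lookup m v)"
  by (auto simp: lookup_tableau_monomial poly_mapping_eq_iff fun_eq_iff)

lemma cnt_pos_iff: "finite A \<Longrightarrow> 0 < cnt A T v \<longleftrightarrow> v \<in> T ` A"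
  unfolding cnt_def by (subst card_gt_0_iff) auto

text \<open>Entries have no bound a priori, but the content determines the set of values, so all
  these fillings take their values from the finite image of any one of them.\<close>

lemma finite_ssyt_content:
  assumes "finite A"
  shows "finite {T \<in> ssyt A. \<forall>v. cnt A T v = h v}"
proof (cases "\<exists>T. \<forall>v. cnt A T v = h v")
  case True
  then obtain T0 where T0: "\<And>v. cnt A T0 v = h v" by blast
  have "{T \<in> ssyt A. \<forall>v. cnt A T v = h v} \<subseteq> A \<rightarrow>\<^sub>E T0 ` A"
  proof
    fix T assume T: "T \<in> {T \<in> ssyt A. \<forall>v. cnt A T v = h v}"
    have "T b \<in> T0 ` A" if "b \<in> A" for b
      using cnt_pos_iff[OF assms, of T "T b"] cnt_pos_iff[OF assms, of T0 "T b"] T T0 that by auto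
    then show "T \<in> A \<rightarrow>\<^sub>E T0 ` A" using T by (auto intro!: PiE_I ssytD(4))
  qed
  then show ?thesis using assms by (rule_tac finite_subset[OF _ finite_PiE]) auto
next
  case False
  then have "{T \<in> ssyt A. \<forall>v. cnt A T v = h v} = {}" by auto
  then show ?thesis by (metis finite.emptyI)
qed

subsection \<open>The Bender--Knuth involution on the columns left of a given one\<close>

definition bk_row :: "(nat \<times> nat) set \<Rightarrow> nat \<Rightarrow> nat \<Rightarrow> (nat \<times> nat \<Rightarrow> nat) \<Rightarrow> nat \<Rightarrow> nat set" where
  "bk_row A k c T i = {j. j < c \<and> (i, j) \<in> A \<and> T (i, j) \<in> {k, Suc k}}"

text \<open>A column is free in row \<open>i\<close> if its box there is its only one with entry \<open>k\<close> or \<open>k + 1\<close>. Since only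
  the position of these two entries matters, the involution does not change which boxes are free.\<close>

definition bk_free :: "(nat \<times> nat) set \<Rightarrow> nat \<Rightarrow> nat \<Rightarrow> (nat \<times> nat \<Rightarrow> nat) \<Rightarrow> nat \<Rightarrow> nat set" where
  "bk_free A k c T i = {j \<in> bk_row A k c T i. j \<notin> bk_row A k c T (Suc i) \<and> j \<notin> bk_row A k c T (i - 1)}"

definition bk_flip :: "(nat \<times> nat) set \<Rightarrow> nat \<Rightarrow> nat \<Rightarrow> (nat \<times> nat \<Rightarrow> nat) \<Rightarrow> nat \<times> nat \<Rightarrow> nat \<times> nat" where
  "bk_flip A k c T = (\<lambda>(i, j). (i, Min (bk_free A k c T i) + Max (bk_free A k c T i) - j))"

text \<open>In a free run, reversing the boxes and then exchanging the values \<open>k\<close> and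
  \<open>k + 1\<close> (by \<open>2 * k + 1 - x\<close>) keeps the run weakly increasing and swaps
  the two multiplicities, without naming them.\<close>

definition bk :: "(nat \<times> nat) set \<Rightarrow> nat \<Rightarrow> nat \<Rightarrow> (nat \<times> nat \<Rightarrow> nat) \<Rightarrow> nat \<times> nat \<Rightarrow> nat" where
  "bk A k c T = (\<lambda>b. if snd b \<in> bk_free A k c T (fst b) then 2 * k + 1 - T (bk_flip A k c T b) else T b)"

text \<open>Only columns left of \<open>c\<close> change. The last assumption protects the seam: a
  \<open>k\<close> in column \<open>c\<close> could otherwise stand to the right of a
  \<open>k\<close> that turns into \<open>k + 1\<close>.\<close>

locale bender_knuth =
  fixes A :: "(nat \<times> nat) set" and k c :: nat and T :: "nat \<times> nat \<Rightarrow> nat"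
  assumes convex: "convex_shape A" and ssyt: "T \<in> ssyt A" and k: "1 \<le> k"
    and no_k: "\<And>i. (i, c) \<in> A \<Longrightarrow> T (i, c) \<noteq> k"
begin

abbreviation "R \<equiv> bk_row A k c T"
abbreviation "F \<equiv> bk_free A k c T"
abbreviation "flip \<equiv> bk_flip A k c T"
abbreviation "T' \<equiv> bk A k c T"

lemma row_finite: "finite (R i)"
  by (rule finite_subset[of _ "{..<c}"]) (auto simp: bk_row_def)

lemma row_Suc:
  assumes "j \<in> R i" "j \<in> R (Suc i)"
  shows "T (i, j) = k" "T (Suc i, j) = Suc k"
  using assms ssytD(2)[OF ssyt, of i j "Suc i"] by (auto simp: bk_row_def)

text \<open>Convexity supplies the box below \<open>j'\<close>; its entry is squeezed between the
  one above it and the \<open>k + 1\<close> to its right. So the boxes paired downwards form the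
  left end of the run in a row, those paired upwards its right end (\<open>row_upset\<close>), and
  the free ones an interval between.\<close>

lemma row_downset:
  assumes "j \<in> R i" "j' \<in> R i" "j' \<le> j" "j \<in> R (Suc i)"
  shows "j' \<in> R (Suc i)"
proof -
  have j: "(i, j') \<in> A" "(Suc i, j) \<in> A" "(i, j) \<in> A" using assms by (auto simp: bk_row_def)
  have A: "(Suc i, j') \<in> A" using convex_shapeD(4)[OF convex j(1,2)] assms by simp
  have "T (Suc i, j') \<le> Suc k" using ssytD(1)[OF ssyt A j(2) assms(3)] row_Suc(2)[OF assms(1,4)] by simp
  moreover have "k < T (Suc i, j')" using ssytD(2)[OF ssyt j(1) A] assms(2) by (auto simp: bk_row_def)
  ultimately show ?thesis using A assms by (auto simp: bk_row_def)
qed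

lemma row_upset:
  assumes "j \<in> R i" "j' \<in> R i" "j \<le> j'" "j \<in> R (i - 1)" "i \<noteq> 0"
  shows "j' \<in> R (i - 1)"
proof -
  obtain i0 where i0: "i = Suc i0" using assms(5) by (cases i) auto
  have j: "(i, j') \<in> A" "(i0, j) \<in> A" using assms i0 by (auto simp: bk_row_def)
  have A: "(i0, j') \<in> A" using convex_shapeD(4)[OF convex j(2,1)] assms i0 by simp
  have "k \<le> T (i0, j')" using ssytD(1)[OF ssyt j(2) A assms(3)] row_Suc(1)[of j i0] assms i0 by simp
  moreover have "T (i0, j') < Suc k" using ssytD(2)[OF ssyt A j(1)] i0 assms(2) by (auto simp: bk_row_def)
  ultimately show ?thesis using A assms i0 by (auto simp: bk_row_def)
qed

lemma row_interval:
  assumes "j \<in> R i" "j' \<in> R i" "j \<le> x" "x \<le> j'"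
  shows "x \<in> R i"
proof -
  have A: "(i, j) \<in> A" "(i, j') \<in> A" using assms by (auto simp: bk_row_def)
  have x: "(i, x) \<in> A" using convex_shapeD(4)[OF convex A] assms by simp
  show ?thesis
    using ssytD(1)[OF ssyt A(1) x assms(3)] ssytD(1)[OF ssyt x A(2) assms(4)] assms x
    by (auto simp: bk_row_def)
qed

lemma row_pos: "j \<in> R i \<Longrightarrow> i \<noteq> 0"
  using convex_shapeD(2)[OF convex] by (fastforce simp: bk_row_def)

lemma free_interval:
  assumes "j \<in> F i" "j' \<in> F i" "j \<le> x" "x \<le> j'"
  shows "x \<in> F i"
proof -
  have jR: "j \<in> R i" "j' \<in> R i" using assms by (auto simp: bk_free_def)
  have x: "x \<in> R i" using row_interval[OF jR assms(3,4)] .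
  show ?thesis using x row_downset[OF x jR(1) assms(3)] row_upset[OF x jR(2) assms(4)] row_pos[OF x] assms(1,2)
    by (auto simp: bk_free_def)
qed

lemma free_finite: "finite (F i)"
  by (rule finite_subset[OF _ row_finite[of i]]) (auto simp: bk_free_def)

lemma free_flip:
  assumes "j \<in> F i"
  shows "Min (F i) + Max (F i) - j \<in> F i" "Min (F i) \<le> j" "j \<le> Max (F i)"
proof -
  have ne: "F i \<noteq> {}" using assms by auto
  show b: "Min (F i) \<le> j" "j \<le> Max (F i)" using assms free_finite by auto
  show "Min (F i) + Max (F i) - j \<in> F i"
    by (rule free_interval[OF Min_in[OF free_finite ne] Max_in[OF free_finite ne]]) (use b in auto)
qed

lemma free_val: "j \<in> F i \<Longrightarrow> (i, j) \<in> A \<and> j < c \<and> T (i, j) \<in> {k, Suc k}"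
  by (auto simp: bk_free_def bk_row_def)

lemma T'_free: "j \<in> F i \<Longrightarrow> T' (i, j) = 2 * k + 1 - T (i, Min (F i) + Max (F i) - j)"
  by (simp add: bk_def bk_flip_def)

lemma T'_nonfree: "j \<notin> F i \<Longrightarrow> T' (i, j) = T (i, j)"
  by (simp add: bk_def)

lemma T'_free_val: "j \<in> F i \<Longrightarrow> T' (i, j) \<in> {k, Suc k}"
  using T'_free[of j i] free_val[OF free_flip(1)[of j i]] by auto

lemma row_T': "bk_row A k c T' = R"
proof -
  have "T' (i, j) \<in> {k, Suc k} \<longleftrightarrow> T (i, j) \<in> {k, Suc k}" for i j
    using T'_free_val free_val T'_nonfree by (cases "j \<in> F i") metis+
  then show ?thesis unfolding bk_row_def fun_eq_iff by blast
qed

lemma free_T': "bk_free A k c T' = F"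
  unfolding bk_free_def row_T' ..

lemma bk_bk: "bk A k c T' = T"
proof
  fix b :: "nat \<times> nat"
  obtain i j where b: "b = (i, j)" by (cases b)
  show "bk A k c T' b = T b"
  proof (cases "j \<in> F i")
    case True
    let ?r = "Min (F i) + Max (F i) - j"
    have r: "?r \<in> F i" "Min (F i) + Max (F i) - ?r = j" using free_flip[OF True] by auto
    have "bk A k c T' b = 2 * k + 1 - T' (i, ?r)" using True by (simp add: b bk_def[of A k c T'] free_T' bk_flip_def)
    also have "\<dots> = 2 * k + 1 - (2 * k + 1 - T (i, j))" using T'_free[OF r(1)] r(2) by simp
    also have "\<dots> = T (i, j)" using free_val[OF True] by auto
    finally show ?thesis by (simp add: b)
  next
    case False
    then show ?thesis by (simp add: b bk_def[of A k c T'] free_T' T'_nonfree)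
  qed
qed

lemma T'_right: "c \<le> j \<Longrightarrow> T' (i, j) = T (i, j)"
  using free_val T'_nonfree by (metis not_le)

lemma nonfree_k:
  assumes "j \<in> R i" "j \<notin> F i"
  shows "T (i, j) = k \<longleftrightarrow> j \<in> R (Suc i)" "T (i, j) = Suc k \<longleftrightarrow> j \<in> R (i - 1)"
proof -
  have v: "T (i, j) \<in> {k, Suc k}" using assms(1) by (simp add: bk_row_def)
  have or: "j \<in> R (Suc i) \<or> j \<in> R (i - 1)" using assms by (auto simp: bk_free_def)
  have "j \<in> R (Suc i) \<Longrightarrow> T (i, j) = k" using row_Suc(1)[OF assms(1)] .
  moreover have "j \<in> R (i - 1) \<Longrightarrow> T (i, j) = Suc k"
    using row_Suc(2)[of j "i - 1"] assms(1) row_pos[OF assms(1)] by simp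
  ultimately show "T (i, j) = k \<longleftrightarrow> j \<in> R (Suc i)" "T (i, j) = Suc k \<longleftrightarrow> j \<in> R (i - 1)"
    using or v by auto
qed

lemma T'_ssyt: "T' \<in> ssyt A"
proof -
  have row: "T' (i, j) \<le> T' (i, j')" if A: "(i, j) \<in> A" "(i, j') \<in> A" and lt: "j < j'" for i j j'
  proof -
    have le: "T (i, j) \<le> T (i, j')" using ssytD(1)[OF ssyt A] lt by simp
    show ?thesis
    proof (cases "j \<in> F i"; cases "j' \<in> F i")
      assume F: "j \<in> F i" "j' \<in> F i"
      \<comment> \<open>The reflection reverses the order of the columns and the exchange of values
        reverses it again.\<close>
      have "T (i, Min (F i) + Max (F i) - j') \<le> T (i, Min (F i) + Max (F i) - j)"
        by (rule ssytD(1)[OF ssyt]) (use free_val[OF free_flip(1)[OF F(1)]] free_val[OF free_flip(1)[OF F(2)]] F lt in auto)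
      then show ?thesis using T'_free F by simp
    next
      assume F: "j \<in> F i" "j' \<notin> F i"
      have "T' (i, j) \<le> Suc k" using T'_free_val[OF F(1)] by auto
      moreover have "T (i, j') \<noteq> k"
      proof
        assume eq: "T (i, j') = k"
        have jk: "T (i, j) = k" using le eq free_val[OF F(1)] by auto
        \<comment> \<open>If \<open>c\<close> lay between \<open>j\<close> and \<open>j'\<close>,
          the entry of row \<open>i\<close> in column \<open>c\<close> would be squeezed between two
          entries \<open>k\<close>.\<close>
        have "j' < c"
        proof (rule ccontr)
          assume "\<not> j' < c"
          then have "(i, c) \<in> A" using convex_shapeD(4)[OF convex A, of i c] free_val[OF F(1)] by auto
          moreover have "T (i, c) = k"
            using ssytD(1)[OF ssyt A(1) \<open>(i, c) \<in> A\<close>] ssytD(1)[OF ssyt \<open>(i, c) \<in> A\<close> A(2)] \<open>\<not> j' < c\<close> free_val[OF F(1)] eq jk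
            by auto
          ultimately show False using no_k by blast
        qed
        then have j'R: "j' \<in> R i" using A eq by (auto simp: bk_row_def)
        have "j' \<in> R (Suc i)" using nonfree_k(1)[OF j'R F(2)] eq by simp
        then have "j \<in> R (Suc i)" using row_downset[OF j'R _ _] F(1) lt by (auto simp: bk_free_def)
        then show False using F(1) by (auto simp: bk_free_def)
      qed
      ultimately show ?thesis using le free_val[OF F(1)] T'_nonfree[OF F(2)] by auto
    next
      assume F: "j \<notin> F i" "j' \<in> F i"
      have "T (i, j) \<noteq> Suc k"
      proof
        assume eq: "T (i, j) = Suc k"
        have jR: "j \<in> R i" using A eq lt free_val[OF F(2)] by (auto simp: bk_row_def)
        have "j \<in> R (i - 1)" using nonfree_k(2)[OF jR F(1)] eq by simp
        then have "j' \<in> R (i - 1)" using row_upset[OF jR _ _] F(2) lt row_pos[OF jR] by (auto simp: bk_free_def)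
        then show False using F(2) by (auto simp: bk_free_def)
      qed
      then have "T (i, j) \<le> k" using le free_val[OF F(2)] by auto
      then show ?thesis using T'_nonfree[OF F(1)] T'_free_val[OF F(2)] by auto
    next
      assume "j \<notin> F i" "j' \<notin> F i"
      then show ?thesis using le T'_nonfree by simp
    qed
  qed
  have col: "T' (i, j) < T' (i', j)" if A: "(i, j) \<in> A" "(i', j) \<in> A" and lt: "i < i'" for i i' j
  proof -
    have le: "T (i, j) < T (i', j)" using ssytD(2)[OF ssyt A] lt by simp
    \<comment> \<open>Two boxes of one column with entries in \<open>{k, Suc k}\<close> are
      vertically adjacent, so neither is free.\<close>
    have sep: False if "j \<in> R i" "j \<in> R i'" "j \<in> F i \<or> j \<in> F i'"
    proof -
      have "T (i, j) + (i' - i) \<le> T (i', j)" using ssyt_weak_mono[OF convex ssyt A] lt by simp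
      then have "i' = Suc i" using that(1,2) lt by (auto simp: bk_row_def)
      then show False using that by (auto simp: bk_free_def)
    qed
    have FR: "j \<in> R i" if "j \<in> F i" for i using that by (simp add: bk_free_def)
    show ?thesis
    proof (cases "j \<in> F i"; cases "j \<in> F i'")
      assume F: "j \<in> F i" "j \<notin> F i'"
      then have "j \<notin> R i'" using sep FR by blast
      then have "T (i', j) \<notin> {k, Suc k}" using free_val[OF F(1)] A by (auto simp: bk_row_def)
      then show ?thesis using le free_val[OF F(1)] T'_free_val[OF F(1)] T'_nonfree[OF F(2)] by auto
    next
      assume F: "j \<notin> F i" "j \<in> F i'"
      then have "j \<notin> R i" using sep FR by blast
      then have "T (i, j) \<notin> {k, Suc k}" using free_val[OF F(2)] A by (auto simp: bk_row_def)
      then show ?thesis using le free_val[OF F(2)] T'_free_val[OF F(2)] T'_nonfree[OF F(1)] by auto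
    qed (use sep FR le T'_nonfree in auto)
  qed
  have "1 \<le> T' b" if "b \<in> A" for b
    using ssytD(3)[OF ssyt that] T'_free_val[of "snd b" "fst b"] T'_nonfree[of "snd b" "fst b"] k
    by (cases "snd b \<in> F (fst b)") auto
  moreover have "T' b = undefined" if "b \<notin> A" for b
    using ssytD(4)[OF ssyt that] T'_nonfree[of "snd b" "fst b"] free_val[of "snd b" "fst b"] that
    by (cases "snd b \<in> F (fst b)") auto
  ultimately show ?thesis unfolding ssyt_def using row col
    by (auto simp: PiE_def extensional_def Pi_def)
qed

lemma cnt_free:
  assumes "{v, v'} = {k, Suc k}"
  shows "card {b \<in> A. snd b \<in> F (fst b) \<and> T' b = v} = card {b \<in> A. snd b \<in> F (fst b) \<and> T b = v'}"
proof (rule bij_betw_same_card)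
  have v: "2 * k + 1 - v = v'" "2 * k + 1 - v' = v" using assms by (auto simp: doubleton_eq_iff)
  have "2 * k + 1 - x = v \<longleftrightarrow> x = v'" if "x \<in> {k, Suc k}" for x using v that by auto
  then have *: "T' (i, j) = v \<longleftrightarrow> T (i, Min (F i) + Max (F i) - j) = v'" if "j \<in> F i" for i j
    using T'_free[OF that] free_val[OF free_flip(1)[OF that]] by metis
  have F: "F i \<subseteq> {j. (i, j) \<in> A}" for i using free_val by auto
  show "bij_betw flip {b \<in> A. snd b \<in> F (fst b) \<and> T' b = v} {b \<in> A. snd b \<in> F (fst b) \<and> T b = v'}"
  proof (rule bij_betw_byWitness[where f' = flip])
    show "\<forall>a\<in>{b \<in> A. snd b \<in> F (fst b) \<and> T' b = v}. flip (flip a) = a"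
      using free_flip by (fastforce simp: bk_flip_def)
    show "\<forall>a\<in>{b \<in> A. snd b \<in> F (fst b) \<and> T b = v'}. flip (flip a) = a"
      using free_flip by (fastforce simp: bk_flip_def)
    show "flip ` {b \<in> A. snd b \<in> F (fst b) \<and> T' b = v} \<subseteq> {b \<in> A. snd b \<in> F (fst b) \<and> T b = v'}"
      using free_flip(1) * F by (fastforce simp: bk_flip_def)
    show "flip ` {b \<in> A. snd b \<in> F (fst b) \<and> T b = v'} \<subseteq> {b \<in> A. snd b \<in> F (fst b) \<and> T' b = v}"
    proof
      fix b assume "b \<in> flip ` {b \<in> A. snd b \<in> F (fst b) \<and> T b = v'}"
      then obtain i j where b: "b = flip (i, j)" "j \<in> F i" "T (i, j) = v'" by auto
      let ?r = "Min (F i) + Max (F i) - j"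
      have r: "?r \<in> F i" "Min (F i) + Max (F i) - ?r = j" using free_flip[OF b(2)] by auto
      show "b \<in> {b \<in> A. snd b \<in> F (fst b) \<and> T' b = v}"
        using *[OF r(1)] r b F by (auto simp: bk_flip_def)
    qed
  qed
qed

text \<open>The non-free boxes left of \<open>c\<close> come in vertical pairs, \<open>k\<close>
  above \<open>k + 1\<close>.\<close>

lemma cnt_paired:
  "card {b \<in> A. snd b < c \<and> snd b \<notin> F (fst b) \<and> T b = k} =
   card {b \<in> A. snd b < c \<and> snd b \<notin> F (fst b) \<and> T b = Suc k}" (is "card ?X = card ?Y")
proof (rule bij_betw_same_card)
  have X: "(i, j) \<in> ?X \<longleftrightarrow> j \<in> R i \<and> j \<in> R (Suc i)" for i j
    using nonfree_k(1)[of j i] by (auto simp: bk_row_def bk_free_def)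
  have Y: "(i, j) \<in> ?Y \<longleftrightarrow> j \<in> R i \<and> j \<in> R (i - 1)" for i j
    using nonfree_k(2)[of j i] row_pos[of j i] row_Suc[of j "i - 1"]
    by (auto simp: bk_row_def bk_free_def)
  show "bij_betw (\<lambda>(i, j). (Suc i, j)) ?X ?Y"
  proof (rule bij_betw_byWitness[where f' = "\<lambda>(i, j). (i - 1, j)"])
    show "\<forall>b\<in>?X. (\<lambda>(i, j). (i - 1, j)) ((\<lambda>(i, j). (Suc i, j)) b) = b" by auto
    show "\<forall>b\<in>?Y. (\<lambda>(i, j). (Suc i, j)) ((\<lambda>(i, j). (i - 1, j)) b) = b"
      using row_pos Y by fastforce
    show "(\<lambda>(i, j). (Suc i, j)) ` ?X \<subseteq> ?Y"
    proof
      fix b assume "b \<in> (\<lambda>(i, j). (Suc i, j)) ` ?X"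
      then obtain i j where "b = (Suc i, j)" "(i, j) \<in> ?X" by auto
      then show "b \<in> ?Y" using X[of i j] Y[of "Suc i" j] by auto
    qed
    show "(\<lambda>(i, j). (i - 1, j)) ` ?Y \<subseteq> ?X"
    proof
      fix b assume "b \<in> (\<lambda>(i, j). (i - 1, j)) ` ?Y"
      then obtain i j where "b = (i - 1, j)" "(i, j) \<in> ?Y" by auto
      then show "b \<in> ?X" using X[of "i - 1" j] Y[of i j] row_pos[of j i] by auto
    qed
  qed
qed

lemma cnt_split:
  assumes "finite A" and c: "\<forall>i j. j \<in> G i \<longrightarrow> j < c"
  shows "cnt A S v = col_cnt A S c v + card {b \<in> A. snd b < c \<and> snd b \<notin> G (fst b) \<and> S b = v}
     + card {b \<in> A. snd b \<in> G (fst b) \<and> S b = v}"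
proof -
  have "{b \<in> A. S b = v} = ({b \<in> A. c \<le> snd b \<and> S b = v} \<union> {b \<in> A. snd b < c \<and> snd b \<notin> G (fst b) \<and> S b = v})
     \<union> {b \<in> A. snd b \<in> G (fst b) \<and> S b = v}" using c by auto
  moreover have "card \<dots> = card {b \<in> A. c \<le> snd b \<and> S b = v} + card {b \<in> A. snd b < c \<and> snd b \<notin> G (fst b) \<and> S b = v}
     + card {b \<in> A. snd b \<in> G (fst b) \<and> S b = v}"
    using assms(1) c by (subst card_Un_disjoint, simp, simp, force, subst card_Un_disjoint, auto)
  ultimately show ?thesis unfolding cnt_def col_cnt_def by simp
qed

lemma col_cnt_T': "c \<le> c' \<Longrightarrow> col_cnt A T' c' v = col_cnt A T c' v"
  unfolding col_cnt_def using T'_right by (intro arg_cong[where f = card]) force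

text \<open>Left of \<open>c\<close> the numbers of \<open>k\<close> and \<open>k + 1\<close> are
  exchanged, from \<open>c\<close> on nothing changes. The equations are additive to avoid truncated
  subtraction.\<close>

lemma cnt_T':
  "cnt A T' k + col_cnt A T c (Suc k) = cnt A T (Suc k) + col_cnt A T c k"
  "cnt A T' (Suc k) + col_cnt A T c k = cnt A T k + col_cnt A T c (Suc k)"
  "v \<noteq> k \<Longrightarrow> v \<noteq> Suc k \<Longrightarrow> cnt A T' v = cnt A T v"
proof -
  note fin = convex_shapeD(1)[OF convex]
  have Fc: "\<forall>i j. j \<in> F i \<longrightarrow> j < c" using free_val by blast
  have nf: "{b \<in> A. snd b < c \<and> snd b \<notin> F (fst b) \<and> T' b = v} = {b \<in> A. snd b < c \<and> snd b \<notin> F (fst b) \<and> T b = v}" for v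
    by (intro Collect_cong) (metis T'_nonfree prod.collapse)
  note s = cnt_split[where G = F and S = T', OF fin Fc] cnt_split[where G = F and S = T, OF fin Fc]
  show "cnt A T' k + col_cnt A T c (Suc k) = cnt A T (Suc k) + col_cnt A T c k"
    "cnt A T' (Suc k) + col_cnt A T c k = cnt A T k + col_cnt A T c (Suc k)"
    using cnt_paired cnt_free[of k "Suc k"] cnt_free[of "Suc k" k]
    unfolding s nf col_cnt_T'[OF order_refl] by (simp_all add: insert_commute)
  assume v: "v \<noteq> k" "v \<noteq> Suc k"
  have "T' b = v \<longleftrightarrow> T b = v" for b
    using v T'_nonfree[of "snd b" "fst b"] free_val[of "snd b" "fst b"] T'_free_val[of "snd b" "fst b"]
    by (cases "snd b \<in> F (fst b)") auto
  then show "cnt A T' v = cnt A T v" unfolding cnt_def by simp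
qed

end

subsection \<open>Alternating sums of coefficients\<close>

text \<open>\<open>alt_coeff N nu f\<close> is the coefficient of \<open>nu + delta\<close> in \<open>f\<close> times the Vandermonde alternant in
  \<open>N\<close> variables, where \<open>delta = (N - 1, \<dots>, 1, 0)\<close>. In \<open>alt_monomials\<close> the equation
  \<open>m + delta = w (nu + delta)\<close> is rearranged to avoid subtraction.\<close>

definition alt_monomials :: "nat list \<Rightarrow> (nat \<Rightarrow> nat) \<Rightarrow> monomial set" where
  "alt_monomials nu w = {m. \<forall>i. Poly_Mapping.lookup m i + w i = part nu (w i) + i}"

definition alt_coeff :: "nat \<Rightarrow> nat list \<Rightarrow> power_series \<Rightarrow> int" where
  "alt_coeff N nu f = (\<Sum>w | w permutes {1..N}. sign w * (\<Sum>m\<in>alt_monomials nu w. f m))"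

text \<open>The inner sum of \<open>alt_coeff\<close> is thus a single coefficient, or 0 if the
  equation asks for a negative exponent.\<close>

lemma alt_monomials_subsingleton:
  assumes "m \<in> alt_monomials nu w"
  shows "alt_monomials nu w = {m}"
proof -
  have "m' = m" if "m' \<in> alt_monomials nu w" for m'
  proof (rule poly_mapping_eqI)
    fix i
    have "Poly_Mapping.lookup m i + w i = part nu (w i) + i" "Poly_Mapping.lookup m' i + w i = part nu (w i) + i"
      using assms that by (simp_all add: alt_monomials_def)
    then show "Poly_Mapping.lookup m' i = Poly_Mapping.lookup m i" by linarith
  qed
  then show ?thesis using assms by blast
qed

lemma alt_coeff_diff: "alt_coeff N nu (\<lambda>m. f m - g m) = alt_coeff N nu f - alt_coeff N nu g"
  by (simp add: alt_coeff_def sum_subtractf right_diff_distrib)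

lemma alt_coeff_sum:
  "alt_coeff N nu (\<lambda>m. \<Sum>x\<in>X. a x * f x m) = (\<Sum>x\<in>X. a x * alt_coeff N nu (f x))"
proof -
  have "alt_coeff N nu (\<lambda>m. \<Sum>x\<in>X. a x * f x m) =
      (\<Sum>w | w permutes {1..N}. \<Sum>x\<in>X. a x * (sign w * (\<Sum>m\<in>alt_monomials nu w. f x m)))"
    unfolding alt_coeff_def
    by (subst sum.swap) (simp add: sum_distrib_left mult.left_commute)
  also have "\<dots> = (\<Sum>x\<in>X. a x * alt_coeff N nu (f x))"
    by (subst sum.swap) (simp add: alt_coeff_def sum_distrib_left)
  finally show ?thesis .
qed

lemma permutes_increasing_eq_id:
  fixes w :: "nat \<Rightarrow> nat"
  assumes w: "w permutes {1..N}" and inc: "\<And>k. 1 \<le> k \<Longrightarrow> k < N \<Longrightarrow> w k < w (Suc k)"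
  shows "w = id"
proof (rule permutes_natset_ge[OF w])
  have "i \<le> w i" if "1 \<le> i" "i \<le> N" for i
    using that
  proof (induction i rule: dec_induct)
    case base
    then show ?case using permutes_in_image[OF w, of 1] by simp
  next
    case (step k)
    then show ?case using inc[of k] by simp
  qed
  then show "\<forall>i\<in>{1..N}. i \<le> w i" by simp
qed

lemma part_strict:
  assumes "is_partition nu" "1 \<le> i" "i < j"
  shows "int (part nu j) - int j < int (part nu i) - int i"
  using part_mono[OF assms(1,2), of j] assms(3) by simp

lemma part_strict_iff:
  assumes "is_partition nu" "1 \<le> i" "1 \<le> j"
  shows "int (part nu j) - int j < int (part nu i) - int i \<longleftrightarrow> i < j"
  using part_strict[OF assms(1,2), of j] part_strict[OF assms(1,3), of i] by (cases i j rule: linorder_cases) auto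

lemma alt_coeff_skew_schur_fillings:
  assumes "finite A"
  shows "alt_coeff N nu (skew_schur A) =
    (\<Sum>w | w permutes {1..N}. sign w * int (card {T \<in> ssyt A. \<forall>i. cnt A T i + w i = part nu (w i) + i}))"
proof -
  have "(\<Sum>m\<in>alt_monomials nu w. skew_schur A m) =
      int (card {T \<in> ssyt A. \<forall>i. cnt A T i + w i = part nu (w i) + i})" for w
  proof (cases "alt_monomials nu w = {}")
    case True
    have "tableau_monomial A T \<notin> alt_monomials nu w" for T using True by auto
    then have "\<not> (\<forall>i. cnt A T i + w i = part nu (w i) + i)" for T
      by (simp add: alt_monomials_def lookup_tableau_monomial[OF assms])
    then have "{T \<in> ssyt A. \<forall>i. cnt A T i + w i = part nu (w i) + i} = {}" by blast
    then show ?thesis unfolding True by (metis card.empty of_nat_0 sum.empty)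
  next
    case False
    then obtain m where m: "m \<in> alt_monomials nu w" by blast
    have "tableau_monomial A T = m \<longleftrightarrow> (\<forall>i. cnt A T i + w i = part nu (w i) + i)" for T
    proof -
      have "cnt A T i + w i = part nu (w i) + i \<longleftrightarrow> cnt A T i = Poly_Mapping.lookup m i" for i
      proof -
        have "Poly_Mapping.lookup m i + w i = part nu (w i) + i" using m by (simp add: alt_monomials_def)
        then show ?thesis by linarith
      qed
      then show ?thesis using tableau_monomial_eq_iff[OF assms] by simp
    qed
    then show ?thesis unfolding alt_monomials_subsingleton[OF m] skew_schur_def by simp
  qed
  then show ?thesis by (simp add: alt_coeff_def)
qed

section \<open>Lattice violations and the sign-reversing involution\<close>

lemma cnt_eq_col_cnt: "cnt A T v = col_cnt A T 0 v"
  by (simp add: cnt_def col_cnt_def)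

definition violation :: "(nat \<times> nat) set \<Rightarrow> (nat \<times> nat \<Rightarrow> nat) \<Rightarrow> nat \<Rightarrow> nat \<Rightarrow> bool" where
  "violation A T c v \<longleftrightarrow> 1 \<le> v \<and> col_cnt A T c v < col_cnt A T c (Suc v)"

text \<open>Coming from the right, the first violated cut. The involution leaves all columns from
  there on alone, so it finds the same cut again and, through the least violated value, the same
  \<open>v\<close>.\<close>

definition viol_col :: "(nat \<times> nat) set \<Rightarrow> (nat \<times> nat \<Rightarrow> nat) \<Rightarrow> nat" where
  "viol_col A T = (GREATEST c. \<exists>v. violation A T c v)"

definition viol_val :: "(nat \<times> nat) set \<Rightarrow> (nat \<times> nat \<Rightarrow> nat) \<Rightarrow> nat" where
  "viol_val A T = (LEAST v. violation A T (viol_col A T) v)"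

lemma lattice_iff: "lattice_filling A T \<longleftrightarrow> \<not> (\<exists>c v. violation A T c v)"
  unfolding lattice_filling_def violation_def by (meson not_le)

lemma col_cnt_Suc:
  assumes "finite A" "T \<in> ssyt A"
  shows "col_cnt A T c v = col_cnt A T (Suc c) v + (if \<exists>i. (i, c) \<in> A \<and> T (i, c) = v then 1 else 0)"
proof -
  have "{b \<in> A. c \<le> snd b \<and> T b = v} = {b \<in> A. Suc c \<le> snd b \<and> T b = v} \<union> {b \<in> A. snd b = c \<and> T b = v}"
    by auto
  then have "col_cnt A T c v = col_cnt A T (Suc c) v + card {b \<in> A. snd b = c \<and> T b = v}"
    using assms(1) by (simp add: col_cnt_def card_Un_disjoint disjoint_iff)
  moreover have "card {b \<in> A. snd b = c \<and> T b = v} = (if \<exists>i. (i, c) \<in> A \<and> T (i, c) = v then 1 else 0)"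
  proof (cases "\<exists>i. (i, c) \<in> A \<and> T (i, c) = v")
    case True
    then obtain i where i: "(i, c) \<in> A" "T (i, c) = v" by blast
    have "b = (i, c)" if "b \<in> A" "snd b = c" "T b = v" for b
      using ssyt_column_inj[OF assms(2) i(1), of "fst b"] that i(2) by (cases b) auto
    moreover have "(i, c) \<in> {b \<in> A. snd b = c \<and> T b = v}" using i by simp
    ultimately have "{b \<in> A. snd b = c \<and> T b = v} = {(i, c)}" by blast
    then show ?thesis using True by simp
  next
    case False
    then have "{b \<in> A. snd b = c \<and> T b = v} = {}" by auto
    then show ?thesis using False by (metis card.empty)
  qed
  ultimately show ?thesis by simp
qed

lemma violation_bounded:
  assumes "finite A" "violation A T c v"
  shows "c \<le> Max (snd ` A)"
proof -
  have "{b \<in> A. c \<le> snd b \<and> T b = Suc v} \<noteq> {}"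
    using assms(2) unfolding violation_def col_cnt_def by (metis card.empty not_less_zero)
  then obtain b where "b \<in> A" "c \<le> snd b" by auto
  then show ?thesis using assms(1) by (meson Max_ge finite_imageI imageI order_trans)
qed

lemma viol_col_greatest:
  assumes "finite A" "\<not> lattice_filling A T"
  shows "violation A T (viol_col A T) (viol_val A T)" "viol_col A T < c \<Longrightarrow> \<not> violation A T c v"
proof -
  have ex: "\<exists>c v. violation A T c v" using assms(2) lattice_iff by blast
  have "\<exists>v. violation A T (viol_col A T) v" unfolding viol_col_def
    by (rule GreatestI_ex_nat[of _ "Max (snd ` A)"]) (use ex violation_bounded[OF assms(1)] in blast)+
  then show "violation A T (viol_col A T) (viol_val A T)" unfolding viol_val_def by (auto intro: LeastI)
  show "\<not> violation A T c v" if "viol_col A T < c"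
  proof
    assume "violation A T c v"
    then have "c \<le> viol_col A T" unfolding viol_col_def
      by (intro Greatest_le_nat[of _ _ "Max (snd ` A)"]) (use violation_bounded[OF assms(1)] in blast)+
    then show False using that by simp
  qed
qed

text \<open>Just right of the last violating cut nothing is violated, and a column contains each value at
  most once; so the column at the cut contains \<open>v + 1\<close> but not \<open>v\<close>, and exceeds by exactly one.\<close>

lemma violation_exact:
  assumes "finite A" "T \<in> ssyt A" "\<not> lattice_filling A T"
  shows "1 \<le> viol_val A T"
    "col_cnt A T (viol_col A T) (Suc (viol_val A T)) = Suc (col_cnt A T (viol_col A T) (viol_val A T))"
    "(i, viol_col A T) \<in> A \<Longrightarrow> T (i, viol_col A T) \<noteq> viol_val A T"
proof -
  let ?c = "viol_col A T" and ?v = "viol_val A T"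
  have v: "violation A T ?c ?v" "\<not> violation A T (Suc ?c) ?v"
    using viol_col_greatest[OF assms(1,3)] by auto
  then show "1 \<le> ?v" "col_cnt A T ?c (Suc ?v) = Suc (col_cnt A T ?c ?v)"
    "(i, ?c) \<in> A \<Longrightarrow> T (i, ?c) \<noteq> ?v"
    unfolding violation_def col_cnt_Suc[OF assms(1,2), of ?c] by (auto split: if_splits)
qed

text \<open>The sign-reversing involution of Stembridge's proof of the Littlewood--Richardson rule.\<close>

definition stembridge :: "(nat \<times> nat) set \<Rightarrow> (nat \<times> nat \<Rightarrow> nat) \<Rightarrow> nat \<times> nat \<Rightarrow> nat" where
  "stembridge A T = bk A (viol_val A T) (viol_col A T) T"

text \<open>The excess of exactly one at the cut turns \<open>cnt_T'\<close> into the claims on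
  contents: the content plus \<open>delta\<close> is permuted by the transposition of
  \<open>v\<close> and \<open>v + 1\<close>, which is why signs are reversed.\<close>

lemma stembridge_props:
  assumes A: "convex_shape A" and T: "T \<in> ssyt A" "\<not> lattice_filling A T"
  defines "v \<equiv> viol_val A T"
  shows "stembridge A T \<in> ssyt A" "\<not> lattice_filling A (stembridge A T)"
    "viol_val A (stembridge A T) = v" "stembridge A (stembridge A T) = T"
    "Suc (cnt A (stembridge A T) v) = cnt A T (Suc v)"
    "cnt A (stembridge A T) (Suc v) = Suc (cnt A T v)"
    "x \<noteq> v \<Longrightarrow> x \<noteq> Suc v \<Longrightarrow> cnt A (stembridge A T) x = cnt A T x"
proof -
  note fin = convex_shapeD(1)[OF A]
  define c where "c = viol_col A T"
  note ex = violation_exact[OF fin T, folded v_def c_def]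
  interpret bender_knuth A v c T
    by unfold_locales (use A T ex in auto)
  have T': "stembridge A T = bk A v c T" unfolding stembridge_def v_def c_def ..
  have viol: "violation A T' c' x = violation A T c' x" if "c \<le> c'" for c' x
    unfolding violation_def col_cnt_T'[OF that] ..
  have vc: "violation A T c v" "\<And>c' x. c < c' \<Longrightarrow> \<not> violation A T c' x"
    using viol_col_greatest[OF fin T(2)] unfolding v_def c_def by auto
  have nl: "\<not> lattice_filling A T'" unfolding lattice_iff using viol[of c v] vc(1) by auto
  have c': "viol_col A T' = c"
  proof (rule antisym)
    show "viol_col A T' \<le> c"
      using viol[of "viol_col A T'" "viol_val A T'"] vc(2) viol_col_greatest(1)[OF fin nl] by (meson not_le less_imp_le)
    show "c \<le> viol_col A T'"
      using viol[of c v] vc(1) viol_col_greatest(2)[OF fin nl, of c v] by (meson not_le order_refl)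
  qed
  have v': "viol_val A T' = v"
    unfolding viol_val_def c' viol[OF order_refl] unfolding v_def viol_val_def c_def ..
  show "stembridge A T \<in> ssyt A" "\<not> lattice_filling A (stembridge A T)"
    "viol_val A (stembridge A T) = v" "stembridge A (stembridge A T) = T"
    using T'_ssyt nl v' bk_bk unfolding T' by (simp_all add: stembridge_def[of A T'] c')
  show "Suc (cnt A (stembridge A T) v) = cnt A T (Suc v)"
    "cnt A (stembridge A T) (Suc v) = Suc (cnt A T v)"
    "x \<noteq> v \<Longrightarrow> x \<noteq> Suc v \<Longrightarrow> cnt A (stembridge A T) x = cnt A T x"
    using cnt_T' ex(2) unfolding T' by auto
qed

text \<open>The left-hand side is a signed count of pairs \<open>(w, T)\<close>. Pairs with a
  non-lattice \<open>T\<close> cancel under the involution; the content of a lattice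
  \<open>T\<close> is weakly decreasing, which forces \<open>w = id\<close>.\<close>

lemma alt_coeff_skew_schur:
  assumes A: "convex_shape A" and nu: "is_partition nu" "length nu \<le> N"
  shows "alt_coeff N nu (skew_schur A) = int (card (LR A nu))"
proof -
  note fin = convex_shapeD(1)[OF A]
  define X where "X w = {T \<in> ssyt A. \<forall>i. cnt A T i + w i = part nu (w i) + i}" for w :: "nat \<Rightarrow> nat"
  define S where "S = Sigma {w. w permutes {1..N}} X"
  define good where "good = {p \<in> S. lattice_filling A (snd p)}"
  define bad where "bad = {p \<in> S. \<not> lattice_filling A (snd p)}"
  have finX: "finite (X w)" for w
  proof -
    have "X w \<subseteq> {T \<in> ssyt A. \<forall>i. cnt A T i = part nu (w i) + i - w i}"
      unfolding X_def by (auto intro!: add_implies_diff)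
    then show ?thesis by (rule finite_subset) (rule finite_ssyt_content[OF fin])
  qed
  have finS: "finite S" unfolding S_def using finX by (auto intro: finite_permutations)
  have pn: "part nu i = 0" if "i \<notin> {1..N}" for i using that nu(2) by (auto simp: part_def)
  have cnt0: "cnt A T i = 0" if "w permutes {1..N}" "T \<in> X w" "i \<notin> {1..N}" for w T i
  proof -
    have "cnt A T i + w i = part nu (w i) + i" using that(2) unfolding X_def by blast
    then show ?thesis using permutes_not_in[OF that(1,3)] pn[OF that(3)] by simp
  qed
  have good: "good = {id} \<times> LR A nu"
  proof (intro set_eqI iffI)
    fix p assume p: "p \<in> good"
    obtain w T where wT: "p = (w, T)" by (cases p)
    have w: "w permutes {1..N}" and T: "T \<in> X w" and l: "lattice_filling A T"
      using p wT unfolding good_def S_def by auto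
    have "w = id"
    proof (rule permutes_increasing_eq_id[OF w])
      fix k assume k: "1 \<le> k" "k < N"
      have "cnt A T (Suc k) \<le> cnt A T k"
        using l k unfolding lattice_filling_def cnt_eq_col_cnt by blast
      moreover have eq: "cnt A T i + w i = part nu (w i) + i" for i using T unfolding X_def by blast
      ultimately have "int (part nu (w (Suc k))) - int (w (Suc k)) < int (part nu (w k)) - int (w k)"
        using eq[of k] eq[of "Suc k"] by linarith
      moreover have "w k \<in> {1..N}" "w (Suc k) \<in> {1..N}" using k permutes_in_image[OF w] by auto
      ultimately show "w k < w (Suc k)" using part_strict_iff[OF nu(1)] by simp
    qed
    then show "p \<in> {id} \<times> LR A nu" using wT T l unfolding X_def LR_def by auto
  next
    fix p :: "(nat \<Rightarrow> nat) \<times> (nat \<times> nat \<Rightarrow> nat)" assume "p \<in> {id} \<times> LR A nu"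
    then show "p \<in> good" unfolding good_def S_def X_def LR_def by (auto simp: permutes_id)
  qed
  define phi where "phi p = (fst p \<circ> transpose (viol_val A (snd p)) (Suc (viol_val A (snd p))), stembridge A (snd p))"
    for p :: "(nat \<Rightarrow> nat) \<times> (nat \<times> nat \<Rightarrow> nat)"
  have phi: "phi p \<in> bad \<and> phi (phi p) = p \<and> sign (fst (phi p)) = - sign (fst p)" if "p \<in> bad" for p
  proof -
    obtain w T where wT: "p = (w, T)" by (cases p)
    have w: "w permutes {1..N}" and T: "T \<in> X w" and nl: "\<not> lattice_filling A T" and Ts: "T \<in> ssyt A"
      using that wT unfolding bad_def S_def X_def by auto
    define v where "v = viol_val A T"
    note st = stembridge_props[OF A Ts nl, folded v_def]
    have v1: "1 \<le> v" using violation_exact(1)[OF fin Ts nl] v_def by simp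
    have "cnt A T (Suc v) \<noteq> 0" using st(5) by linarith
    \<comment> \<open>The value \<open>v + 1\<close> occurs in \<open>T\<close>, so the
      transposition stays within the permuted range.\<close>
    then have vN: "Suc v \<in> {1..N}" using cnt0[OF w T, of "Suc v"] by metis
    define t where "t = transpose v (Suc v)"
    have t: "t permutes {1..N}" unfolding t_def using v1 vN by (intro permutes_swap_id) auto
    have phip: "phi p = (w \<circ> t, stembridge A T)" by (simp add: phi_def wT v_def t_def)
    have eq: "cnt A T i + w i = part nu (w i) + i" for i using T unfolding X_def by blast
    have "cnt A (stembridge A T) i + w (t i) = part nu (w (t i)) + i" for i
    proof -
      consider "i = v" | "i = Suc v" | "i \<noteq> v" "i \<noteq> Suc v" by blast
      then show ?thesis
      proof cases
        case 1
        then show ?thesis using st(5) eq[of "Suc v"] by (simp add: t_def)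
      next
        case 2
        then show ?thesis using st(6) eq[of v] by (simp add: t_def)
      next
        case 3
        then show ?thesis using st(7)[of i] eq[of i] by (simp add: t_def transpose_def)
      qed
    qed
    then have "stembridge A T \<in> X (w \<circ> t)" using st(1) unfolding X_def by simp
    then have "phi p \<in> bad" using st(2) permutes_compose[OF t w] unfolding phip bad_def S_def by simp
    moreover have "phi (phi p) = p"
      unfolding phip by (simp add: phi_def st(3,4) wT t_def comp_assoc)
    moreover have "sign (w \<circ> t) = - sign w"
      using sign_compose[of w t] permutes_imp_permutation[OF _ w] permutes_imp_permutation[OF _ t]
      by (simp add: t_def sign_swap_id)
    ultimately show ?thesis using phip wT by simp
  qed
  have "(\<Sum>p\<in>bad. sign (fst p)) = (\<Sum>p\<in>bad. - sign (fst p))"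
    by (rule sum.reindex_bij_witness[of _ phi phi]) (use phi in auto)
  then have bad0: "(\<Sum>p\<in>bad. sign (fst p)) = 0" by (simp add: sum_negf)
  have "alt_coeff N nu (skew_schur A) = (\<Sum>w | w permutes {1..N}. sign w * int (card (X w)))"
    unfolding alt_coeff_skew_schur_fillings[OF fin] X_def ..
  also have "\<dots> = (\<Sum>w | w permutes {1..N}. \<Sum>T\<in>X w. sign w)" by (simp add: mult.commute)
  also have "\<dots> = (\<Sum>p\<in>S. sign (fst p))"
    unfolding S_def by (subst sum.Sigma) (auto simp: finX finite_permutations split_def)
  also have "S = good \<union> bad" unfolding good_def bad_def by blast
  also have "(\<Sum>p\<in>good \<union> bad. sign (fst p)) = (\<Sum>p\<in>good. sign (fst p)) + (\<Sum>p\<in>bad. sign (fst p))"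
    by (rule sum.union_disjoint) (use finS in \<open>auto simp: good_def bad_def\<close>)
  also have "(\<Sum>p\<in>good. sign (fst p)) = (\<Sum>p\<in>good. 1)"
    by (rule sum.cong) (auto simp: good)
  also have "(\<Sum>p\<in>good. 1) + (\<Sum>p\<in>bad. sign (fst p)) = int (card (LR A nu))"
    unfolding bad0 good by (simp add: card_cartesian_product)
  finally show ?thesis .
qed

section \<open>Symmetry of skew Schur functions\<close>

lemma card_involution_le:
  assumes "finite Y" "\<And>x. x \<in> X \<Longrightarrow> g x \<in> Y \<and> g (g x) = x"
  shows "card X \<le> card Y"
  by (rule card_inj_on_le[of g]) (use assms in \<open>auto intro!: inj_onI, metis\<close>)

lemma skew_schur_symmetric:
  assumes A: "convex_shape A" and k: "1 \<le> k"
  shows "skew_schur A (Poly_Mapping.map_key (transpose k (Suc k)) m) = skew_schur A m"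
proof -
  note fin = convex_shapeD(1)[OF A]
  \<comment> \<open>A cut to the right of all columns: the condition on column \<open>c\<close> is
    vacuous and \<open>bk\<close> is the classical Bender-Knuth involution.\<close>
  define c where "c = Suc (Max (insert 0 (snd ` A)))"
  have c: "j < c" if "(i, j) \<in> A" for i j
  proof -
    have "snd (i, j) \<in> insert 0 (snd ` A)" using that by blast
    then show ?thesis unfolding c_def using fin by (auto simp: less_Suc_eq_le intro: Max_ge)
  qed
  let ?t = "transpose k (Suc k)"
  define m' where "m' = Poly_Mapping.map_key ?t m"
  have m': "Poly_Mapping.lookup m' i = Poly_Mapping.lookup m (?t i)" for i
    unfolding m'_def by (simp add: map_key.rep_eq inj_on_transpose)
  have step: "bk A k c T \<in> ssyt A \<and> bk A k c (bk A k c T) = T \<and> (\<forall>v. cnt A (bk A k c T) v = cnt A T (?t v))"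
    if T: "T \<in> ssyt A" for T
  proof -
    interpret bender_knuth A k c T by unfold_locales (use A T k c in auto)
    have "col_cnt A T c v = 0" for v
    proof -
      have "{b \<in> A. c \<le> snd b \<and> T b = v} = {}" using c by (auto simp: not_le)
      then show ?thesis unfolding col_cnt_def by (metis card.empty)
    qed
    then have "cnt A (bk A k c T) v = cnt A T (?t v)" for v
      using cnt_T' by (cases "v = k"; cases "v = Suc k") (auto simp: transpose_def)
    then show ?thesis using T'_ssyt bk_bk by blast
  qed
  define X where "X m = {T \<in> ssyt A. \<forall>v. cnt A T v = Poly_Mapping.lookup m v}" for m
  have finX: "finite (X m)" for m unfolding X_def by (rule finite_ssyt_content[OF fin])
  have "card (X m) \<le> card (X m')"
    by (rule card_involution_le[OF finX, of _ "bk A k c"]) (use step m' in \<open>auto simp: X_def\<close>)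
  moreover have "card (X m') \<le> card (X m)"
    by (rule card_involution_le[OF finX, of _ "bk A k c"]) (use step m' in \<open>auto simp: X_def\<close>)
  ultimately show ?thesis
    unfolding skew_schur_def tableau_monomial_eq_iff[OF fin] X_def m'_def by simp
qed

subsection \<open>Lattice fillings\<close>

text \<open>An injection from the entries \<open>v + 1\<close> to entries \<open>v\<close> weakly
  further right respects every column cut at once.\<close>

lemma lattice_fillingI:
  assumes "finite A"
    and "\<And>v. 1 \<le> v \<Longrightarrow> inj_on (f v) {b \<in> A. T b = Suc v}"
    and "\<And>v b. 1 \<le> v \<Longrightarrow> b \<in> A \<Longrightarrow> T b = Suc v \<Longrightarrow> f v b \<in> A \<and> T (f v b) = v \<and> snd b \<le> snd (f v b)"
  shows "lattice_filling A T"
  unfolding lattice_filling_def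
proof (intro allI impI)
  fix c v :: nat assume v: "1 \<le> v"
  show "col_cnt A T c (Suc v) \<le> col_cnt A T c v" unfolding col_cnt_def
  proof (rule card_inj_on_le[of "f v"])
    show "inj_on (f v) {b \<in> A. c \<le> snd b \<and> T b = Suc v}"
      by (rule inj_on_subset[OF assms(2)[OF v]]) auto
    show "f v ` {b \<in> A. c \<le> snd b \<and> T b = Suc v} \<subseteq> {b \<in> A. c \<le> snd b \<and> T b = v}"
      using assms(3)[OF v] by (auto; force)
  qed (use assms(1) in auto)
qed

definition row_cnt :: "(nat \<times> nat) set \<Rightarrow> (nat \<times> nat \<Rightarrow> nat) \<Rightarrow> nat \<Rightarrow> nat \<Rightarrow> nat" where
  "row_cnt A T j v = card {b \<in> A. fst b \<le> j \<and> T b = v}"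

text \<open>Reading the columns from the right and reading the rows from the top yield the same lattice
  condition: cut at the leftmost column where \<open>v + 1\<close> occurs in the first \<open>j + 1\<close> rows; by
  semistandardness every \<open>v\<close> right of this cut lies in the first \<open>j\<close> rows.\<close>

lemma row_cnt_lattice:
  assumes A: "convex_shape A" and T: "T \<in> ssyt A" "lattice_filling A T" and v: "1 \<le> v"
  shows "row_cnt A T (Suc j) (Suc v) \<le> row_cnt A T j v"
proof (cases "{b \<in> A. fst b \<le> Suc j \<and> T b = Suc v} = {}")
  case True
  then show ?thesis unfolding row_cnt_def by (metis card.empty zero_le)
next
  case False
  note fin = convex_shapeD(1)[OF A]
  let ?X = "{b \<in> A. fst b \<le> Suc j \<and> T b = Suc v}"
  define c where "c = Min (snd ` ?X)"
  have "c \<in> snd ` ?X" unfolding c_def using fin False by (intro Min_in) auto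
  then obtain r where r: "(r, c) \<in> A" "r \<le> Suc j" "T (r, c) = Suc v" by auto
  have c: "c \<le> snd b" if "b \<in> ?X" for b unfolding c_def using fin that by (intro Min_le) auto
  have "row_cnt A T (Suc j) (Suc v) \<le> col_cnt A T c (Suc v)"
    unfolding row_cnt_def col_cnt_def using fin c by (intro card_mono) auto
  also have "\<dots> \<le> col_cnt A T c v" using T(2) v unfolding lattice_filling_def by blast
  also have "\<dots> \<le> row_cnt A T j v" unfolding row_cnt_def col_cnt_def
  proof (rule card_mono)
    show "{b \<in> A. c \<le> snd b \<and> T b = v} \<subseteq> {b \<in> A. fst b \<le> j \<and> T b = v}"
    proof
      fix b assume b: "b \<in> {b \<in> A. c \<le> snd b \<and> T b = v}"
      have "fst b < r"
      proof (rule ccontr)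
        assume "\<not> fst b < r"
        then have "T (r, c) + (fst b - r) \<le> T (fst b, snd b)"
          using b by (intro ssyt_weak_mono[OF A T(1) r(1)]) auto
        then show False using b r(3) by simp
      qed
      then show "b \<in> {b \<in> A. fst b \<le> j \<and> T b = v}" using b r(2) by simp
    qed
  qed (use fin in auto)
  finally show ?thesis .
qed

lemma row_cnt_0: "convex_shape A \<Longrightarrow> row_cnt A T 0 v = 0"
proof -
  assume A: "convex_shape A"
  have "{b \<in> A. fst b \<le> 0 \<and> T b = v} = {}" using convex_shapeD(2)[OF A] by force
  then show ?thesis unfolding row_cnt_def by (metis card.empty)
qed

text \<open>A \<open>v\<close> in the first \<open>j\<close> rows would demand a
  \<open>v - 1\<close> in the first \<open>j - 1\<close> rows, and so on up to the empty row 0.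
  Hence no entry exceeds its row index.\<close>

lemma row_cnt_eq_0:
  assumes A: "convex_shape A" and T: "T \<in> ssyt A" "lattice_filling A T" and "j < v"
  shows "row_cnt A T j v = 0"
  using assms(4)
proof (induction j arbitrary: v)
  case 0
  then show ?case using row_cnt_0[OF A] by simp
next
  case (Suc j)
  then obtain v' where v': "v = Suc v'" "j < v'" by (cases v) auto
  then show ?case using row_cnt_lattice[OF A T, of v' j] Suc.IH[of v'] by simp
qed

text \<open>The lattice condition bounds the entry by \<open>i\<close> from above; the
  \<open>i - 1\<close> boxes over it in a straight shape bound it by \<open>i\<close> from
  below.\<close>

lemma LR_diagram_filling:
  assumes la: "is_partition la" and T: "T \<in> ssyt (diagram la)" "lattice_filling (diagram la) T"
    and ij: "(i, j) \<in> diagram la"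
  shows "T (i, j) = i"
proof (rule antisym)
  note A = diagram_convex[OF la]
  note fin = convex_shapeD(1)[OF A]
  show "T (i, j) \<le> i"
  proof (rule ccontr)
    assume "\<not> T (i, j) \<le> i"
    then have "row_cnt (diagram la) T i (T (i, j)) = 0" using row_cnt_eq_0[OF A T] by simp
    then have "{b \<in> diagram la. fst b \<le> i \<and> T b = T (i, j)} = {}" unfolding row_cnt_def using fin by simp
    then show False using ij by auto
  qed
  have i: "1 \<le> i" using ij by (auto simp: diagram_def)
  then have "(1, j) \<in> diagram la" using ij part_mono[OF la, of 1 i] by (auto simp: mem_diagram)
  then show "i \<le> T (i, j)"
    using ssyt_weak_mono[OF A T(1) _ ij, of 1 j] ssytD(3)[OF T(1), of "(1, j)"] i by auto
qed

lemma cnt_diagram_fst: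
  assumes "\<And>i j. (i, j) \<in> diagram la \<Longrightarrow> T (i, j) = i"
  shows "cnt (diagram la) T v = part la v"
proof -
  have "{b \<in> diagram la. T b = v} = (\<lambda>j. (v, j)) ` {1..part la v}"
    using assms by (auto simp: mem_diagram)
  then show ?thesis by (simp add: cnt_def card_image inj_on_def)
qed

lemma part_inject:
  assumes "is_partition la" "is_partition nu" "\<And>i. part la i = part nu i"
  shows "la = nu"
proof -
  have len: "i < length xs \<longleftrightarrow> part xs (Suc i) \<noteq> 0" if "is_partition xs" for xs i
  proof -
    have "xs ! i \<noteq> 0" if "i < length xs" using nth_mem[OF that] \<open>is_partition xs\<close> unfolding is_partition_def by metis
    then show ?thesis by (auto simp: part_def)
  qed
  have "length la = length nu"
    using len[OF assms(1)] len[OF assms(2)] assms(3) by (metis linorder_neqE_nat less_irrefl)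
  moreover have "la ! i = nu ! i" if "i < length la" for i
    using assms(3)[of "Suc i"] that calculation by (simp add: part_def)
  ultimately show ?thesis by (rule nth_equalityI)
qed

text \<open>The only lattice filling of a straight shape is the one with \<open>i\<close> throughout
  row \<open>i\<close>. This makes the functionals \<open>alt_coeff\<close> dual to the Schur
  functions.\<close>

lemma card_LR_diagram:
  assumes la: "is_partition la" and nu: "is_partition nu"
  shows "card (LR (diagram la) nu) = (if la = nu then 1 else 0)"
proof -
  define T0 where "T0 = restrict fst (diagram la)"
  note A = diagram_convex[OF la]
  have T0: "T0 (i, j) = i" if "(i, j) \<in> diagram la" for i j using that by (simp add: T0_def)
  have sub: "T = T0 \<and> la = nu" if "T \<in> LR (diagram la) nu" for T
  proof -
    have T: "T \<in> ssyt (diagram la)" "lattice_filling (diagram la) T" "\<And>v. cnt (diagram la) T v = part nu v"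
      using that unfolding LR_def by auto
    note f = LR_diagram_filling[OF la T(1,2)]
    have "T = T0"
    proof
      fix b show "T b = T0 b" using f[of "fst b" "snd b"] ssytD(4)[OF T(1)] by (cases "b \<in> diagram la") (auto simp: T0_def)
    qed
    moreover have "la = nu" by (rule part_inject[OF la nu]) (use cnt_diagram_fst[OF f] T(3) in simp)
    ultimately show ?thesis by simp
  qed
  have "T0 \<in> ssyt (diagram la)"
    unfolding ssyt_def using convex_shapeD(2)[OF A] by (auto simp: T0_def)
  moreover have "lattice_filling (diagram la) T0"
  proof (rule lattice_fillingI[where f = "\<lambda>v b. (v, snd b)"])
    fix v :: nat assume v: "1 \<le> v"
    show "inj_on (\<lambda>b. (v, snd b)) {b \<in> diagram la. T0 b = Suc v}"
      by (auto simp: inj_on_def T0_def)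
    fix b assume b: "b \<in> diagram la" "T0 b = Suc v"
    then have "(Suc v, snd b) \<in> diagram la" by (cases b) (auto simp: T0_def)
    then have "(v, snd b) \<in> diagram la" using part_mono[OF la v, of "Suc v"] by (auto simp: mem_diagram)
    then show "(v, snd b) \<in> diagram la \<and> T0 (v, snd b) = v \<and> snd b \<le> snd (v, snd b)" using T0 by simp
  qed (rule finite_diagram)
  ultimately have "T0 \<in> LR (diagram la) la" unfolding LR_def using cnt_diagram_fst[OF T0] by simp
  then have "LR (diagram la) nu = (if la = nu then {T0} else {})" using sub by auto
  then show ?thesis by simp
qed

subsection \<open>The Schur expansion of a skew Schur function\<close>

lemma alt_coeff_schur:
  assumes "is_partition la" "is_partition nu" "length nu \<le> N"
  shows "alt_coeff N nu (schur la) = (if la = nu then 1 else 0)"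
  unfolding schur_def alt_coeff_skew_schur[OF diagram_convex[OF assms(1)] assms(2,3)]
  using card_LR_diagram[OF assms(1,2)] by simp

text \<open>A permutation minimising the right-hand side has no descent, so it is the identity.\<close>

lemma rearrangement_strict:
  fixes beta :: "nat \<Rightarrow> int"
  assumes dec: "\<And>i j. 1 \<le> i \<Longrightarrow> i < j \<Longrightarrow> j \<le> N \<Longrightarrow> beta j < beta i"
    and w: "w permutes {1..N}" "w \<noteq> id"
  shows "(\<Sum>i\<in>{1..N}. int i * beta i) < (\<Sum>i\<in>{1..N}. int i * beta (w i))"
proof -
  define F where "F w = (\<Sum>i\<in>{1..N}. int i * beta (w i))" for w
  let ?P = "{w. w permutes {1..N}}"
  have finP: "finite ?P" "?P \<noteq> {}" using finite_permutations[of "{1..N}"] permutes_id[of "{1..N}"] by blast+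
  have desc: "\<exists>w'\<in>?P. F w' < F u" if u: "u permutes {1..N}" "u \<noteq> id" for u
  proof -
    obtain k where k: "1 \<le> k" "k < N" "\<not> u k < u (Suc k)"
      using permutes_increasing_eq_id[OF u(1)] u(2) by blast
    have "u k \<noteq> u (Suc k)" using permutes_inj[OF u(1)] by (metis injD n_not_Suc_n)
    then have lt: "u (Suc k) < u k" using k(3) by simp
    have in_: "u k \<in> {1..N}" "u (Suc k) \<in> {1..N}" using permutes_in_image[OF u(1)] k by auto
    define t where "t = transpose k (Suc k)"
    have t: "t permutes {1..N}" unfolding t_def using k by (intro permutes_swap_id) auto
    have set: "{1..N} = insert k (insert (Suc k) ({1..N} - {k, Suc k}))" using k by auto
    have "(\<Sum>i\<in>{1..N} - {k, Suc k}. int i * beta ((u \<circ> t) i)) = (\<Sum>i\<in>{1..N} - {k, Suc k}. int i * beta (u i))"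
      by (rule sum.cong) (auto simp: t_def transpose_def)
    then have "F (u \<circ> t) - F u = beta (u k) - beta (u (Suc k))"
      unfolding F_def by (subst (1 2) set) (simp add: t_def algebra_simps)
    moreover have "beta (u k) < beta (u (Suc k))" using dec[OF _ lt] in_ by simp
    ultimately show ?thesis using permutes_compose[OF t u(1)] by (intro bexI[of _ "u \<circ> t"]) auto
  qed
  have "Min (F ` ?P) \<in> F ` ?P" using finP by (intro Min_in) auto
  then obtain u where u: "u permutes {1..N}" "F u = Min (F ` ?P)" by auto
  have min: "F u \<le> F w'" if "w' permutes {1..N}" for w' unfolding u(2) using finP(1) that by (intro Min_le) auto
  have "u = id" using desc[OF u(1)] min by force
  obtain w' where "w' permutes {1..N}" "F w' < F w" using desc[OF w] by auto
  then show ?thesis using min[of w'] \<open>u = id\<close> by (simp add: F_def)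
qed

text \<open>The exponents are \<open>beta (w i) + i\<close>. After squaring, only the cross term
  depends on \<open>w\<close>, and by rearrangement it is least at the identity alone.\<close>

lemma permuted_sum_squares:
  assumes nu: "is_partition nu" and w: "w permutes {1..N}" "w \<noteq> id" and m: "m \<in> alt_monomials nu w"
  shows "(\<Sum>i\<in>{1..N}. (part nu i)\<^sup>2) < (\<Sum>i\<in>{1..N}. (Poly_Mapping.lookup m i)\<^sup>2)"
proof -
  define beta where "beta i = int (part nu i) - int i" for i
  have "int (Poly_Mapping.lookup m i) = beta (w i) + int i" for i
  proof -
    have "Poly_Mapping.lookup m i + w i = part nu (w i) + i" using m unfolding alt_monomials_def by blast
    then show ?thesis unfolding beta_def by linarith
  qed
  then have "(\<Sum>i\<in>{1..N}. (int (Poly_Mapping.lookup m i))\<^sup>2) =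
      (\<Sum>i\<in>{1..N}. (beta (w i))\<^sup>2) + 2 * (\<Sum>i\<in>{1..N}. int i * beta (w i)) + (\<Sum>i\<in>{1..N}. (int i)\<^sup>2)"
    by (simp add: power2_sum sum.distrib sum_distrib_left mult_ac)
  also have "(\<Sum>i\<in>{1..N}. (beta (w i))\<^sup>2) = (\<Sum>i\<in>{1..N}. (beta i)\<^sup>2)"
    using sum.permute[OF w(1), of "\<lambda>i. (beta i)\<^sup>2"] by (simp add: comp_def)
  finally have "(\<Sum>i\<in>{1..N}. (int (Poly_Mapping.lookup m i))\<^sup>2) =
      (\<Sum>i\<in>{1..N}. (beta i)\<^sup>2) + 2 * (\<Sum>i\<in>{1..N}. int i * beta (w i)) + (\<Sum>i\<in>{1..N}. (int i)\<^sup>2)" .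
  moreover have "(\<Sum>i\<in>{1..N}. int i * beta i) < (\<Sum>i\<in>{1..N}. int i * beta (w i))"
    by (rule rearrangement_strict[OF _ w]) (use part_strict[OF nu] in \<open>auto simp: beta_def\<close>)
  moreover have "(\<Sum>i\<in>{1..N}. (int (part nu i))\<^sup>2) =
      (\<Sum>i\<in>{1..N}. (beta i)\<^sup>2) + 2 * (\<Sum>i\<in>{1..N}. int i * beta i) + (\<Sum>i\<in>{1..N}. (int i)\<^sup>2)"
  proof -
    have "int (part nu i) = beta i + int i" for i by (simp add: beta_def)
    then show ?thesis by (simp add: power2_sum sum.distrib sum_distrib_left mult_ac)
  qed
  ultimately have "(\<Sum>i\<in>{1..N}. (int (part nu i))\<^sup>2) < (\<Sum>i\<in>{1..N}. (int (Poly_Mapping.lookup m i))\<^sup>2)"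
    by linarith
  then have "int (\<Sum>i\<in>{1..N}. (part nu i)\<^sup>2) < int (\<Sum>i\<in>{1..N}. (Poly_Mapping.lookup m i)\<^sup>2)"
    by (simp only: of_nat_sum of_nat_power)
  then show ?thesis by linarith
qed


lemma partition_of_decreasing:
  fixes h :: "nat \<Rightarrow> nat"
  assumes "h 0 = 0" and dec: "\<And>i. 1 \<le> i \<Longrightarrow> h (Suc i) \<le> h i" and "\<And>i. N < i \<Longrightarrow> h i = 0"
  obtains nu where "is_partition nu" "length nu \<le> N" "\<And>i. part nu i = h i"
proof -
  define L where "L = (LEAST i. h (Suc i) = 0)"
  have L0: "h (Suc L) = 0" unfolding L_def by (rule LeastI[of _ N]) (use assms(3) in simp)
  have LN: "L \<le> N" unfolding L_def by (rule Least_le) (use assms(3) in simp)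
  have Lpos: "h (Suc i) \<noteq> 0" if "i < L" for i using not_less_Least that unfolding L_def by blast
  have mono: "h j \<le> h i" if "1 \<le> i" "i \<le> j" for i j
    using that(2)
  proof (induction j rule: dec_induct)
    case (step j)
    then show ?case using dec[of j] that(1) by simp
  qed simp
  define nu where "nu = map h [1..<Suc L]"
  have len: "length nu = L" by (simp add: nu_def)
  have nth: "nu ! i = h (Suc i)" if "i < L" for i using that by (simp add: nu_def del: upt_Suc)
  have "part nu i = h i" for i
  proof (cases "i = 0 \<or> L < i")
    case True
    then show ?thesis using assms(1) L0 mono[of "Suc L" i] by (auto simp: part_def len)
  next
    case False
    then show ?thesis using nth[of "i - 1"] by (auto simp: part_def len)
  qed
  moreover have "is_partition nu" unfolding is_partition_def
  proof
    show "sorted_wrt (\<ge>) nu" unfolding sorted_wrt_iff_nth_less len using nth mono by simp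
    show "0 \<notin> set nu" using Lpos nth by (auto simp: in_set_conv_nth len)
  qed
  ultimately show ?thesis using that len LN by simp
qed

lemma finite_bounded_monomials: "finite {m :: monomial. Poly_Mapping.keys m \<subseteq> {1..N} \<and> (\<forall>i. Poly_Mapping.lookup m i \<le> n)}"
  (is "finite ?S")
proof (rule finite_imageD)
  have "finite {f. \<forall>i :: nat. (i \<in> {1..N} \<longrightarrow> f i \<in> {..n}) \<and> (i \<notin> {1..N} \<longrightarrow> f i = 0)}"
    by (rule finite_set_of_finite_funs) auto
  moreover have "Poly_Mapping.lookup ` ?S \<subseteq> {f. \<forall>i. (i \<in> {1..N} \<longrightarrow> f i \<in> {..n}) \<and> (i \<notin> {1..N} \<longrightarrow> f i = 0)}"
    by (auto simp: in_keys_iff subset_iff)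
  ultimately show "finite (Poly_Mapping.lookup ` ?S)" by (rule rev_finite_subset)
  show "inj_on Poly_Mapping.lookup ?S" by (rule inj_onI, rule poly_mapping_eqI) simp
qed

text \<open>The other monomials in the alternating sum of the sorted monomial \<open>nu\<close> have larger sum of
  squares, hence do not occur if \<open>nu\<close> is chosen with maximal sum of squares.\<close>

lemma symmetric_eq_0:
  fixes g :: power_series
  assumes sym: "\<And>k m. 1 \<le> k \<Longrightarrow> g (Poly_Mapping.map_key (transpose k (Suc k)) m) = g m"
    and zero: "\<And>m. g m \<noteq> 0 \<Longrightarrow> Poly_Mapping.lookup m 0 = 0"
    and bounded: "\<And>m i. g m \<noteq> 0 \<Longrightarrow> Poly_Mapping.lookup m i \<le> n"
    and alt: "\<And>N nu. is_partition nu \<Longrightarrow> length nu \<le> N \<Longrightarrow> alt_coeff N nu g = 0"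
  shows "g m = 0"
proof (rule ccontr)
  assume gm: "g m \<noteq> 0"
  define N where "N = Max (insert 0 (Poly_Mapping.keys m))"
  define S where "S = {m. g m \<noteq> 0 \<and> Poly_Mapping.keys m \<subseteq> {1..N}}"
  define sq where "sq m = (\<Sum>i\<in>{1..N}. (Poly_Mapping.lookup m i)\<^sup>2)" for m :: monomial
  \<comment> \<open>Among the monomials of maximal sum of squares, one of least \<open>wt\<close>
    has decreasing exponents: exchanging an adjacent ascent stays in the set by symmetry, keeps the
    squares and lowers \<open>wt\<close>.\<close>
  define wt where "wt m = (\<Sum>i\<in>{1..N}. i * Poly_Mapping.lookup m i)" for m :: monomial
  have "0 \<notin> Poly_Mapping.keys m" using zero[OF gm] by (simp add: in_keys_iff)
  moreover have "i \<le> N" if "i \<in> Poly_Mapping.keys m" for i unfolding N_def using that by (intro Max_ge) auto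
  ultimately have "Poly_Mapping.keys m \<subseteq> {1..N}" by (auto simp: Suc_le_eq intro!: gr0I)
  then have "m \<in> S" using gm by (simp add: S_def)
  have finS: "finite S"
    by (rule finite_subset[OF _ finite_bounded_monomials[of N n]]) (use bounded in \<open>auto simp: S_def\<close>)
  define S' where "S' = {m \<in> S. sq m = Max (sq ` S)}"
  have "Max (sq ` S) \<in> sq ` S" using finS \<open>m \<in> S\<close> by (intro Max_in) auto
  then have S': "finite S'" "S' \<noteq> {}" using finS unfolding S'_def by auto
  then have "Min (wt ` S') \<in> wt ` S'" by (intro Min_in) auto
  then obtain mu where mu: "mu \<in> S'" "wt mu = Min (wt ` S')" by auto
  have gmu: "g mu \<noteq> 0" and kmu: "Poly_Mapping.keys mu \<subseteq> {1..N}" using mu(1) unfolding S'_def S_def by auto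
  have sq_max: "sq m' \<le> sq mu" if "m' \<in> S" for m' using mu(1) finS that unfolding S'_def by simp
  have wt_min: "wt mu \<le> wt m'" if "m' \<in> S'" for m' using mu(2) S'(1) that by simp
  have out: "Poly_Mapping.lookup mu i = 0" if "i \<notin> {1..N}" for i using kmu that by (auto simp: in_keys_iff)
  have dec: "Poly_Mapping.lookup mu (Suc k) \<le> Poly_Mapping.lookup mu k" if k: "1 \<le> k" for k
  proof (cases "k < N")
    case True
    define t where "t = transpose k (Suc k)"
    have t: "t permutes {1..N}" unfolding t_def using k True by (intro permutes_swap_id) auto
    define m' where "m' = Poly_Mapping.map_key t mu"
    have m': "Poly_Mapping.lookup m' i = Poly_Mapping.lookup mu (t i)" for i
      unfolding m'_def using permutes_inj[OF t] by (simp add: map_key.rep_eq)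
    have "g m' \<noteq> 0" unfolding m'_def t_def using sym[OF k] gmu by simp
    moreover have "Poly_Mapping.keys m' \<subseteq> {1..N}"
      using out permutes_not_in[OF t] by (auto simp: in_keys_iff m') (metis atLeastAtMost_iff not_gr_zero One_nat_def)+
    moreover have "sq m' = sq mu"
      using sum.permute[OF t, of "\<lambda>i. (Poly_Mapping.lookup mu i)\<^sup>2"] by (simp add: sq_def m' comp_def)
    ultimately have "m' \<in> S'" using mu(1) unfolding S'_def S_def by simp
    then have le: "wt mu \<le> wt m'" by (rule wt_min)
    have set: "{1..N} = insert k (insert (Suc k) ({1..N} - {k, Suc k}))" using k True by auto
    have rest: "(\<Sum>i\<in>{1..N} - {k, Suc k}. i * Poly_Mapping.lookup mu (t i)) = (\<Sum>i\<in>{1..N} - {k, Suc k}. i * Poly_Mapping.lookup mu i)"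
      by (rule sum.cong) (auto simp: t_def transpose_def)
    show ?thesis using le unfolding wt_def m' by (subst (asm) (1 2) set) (simp add: rest, simp add: t_def)
  next
    case False
    then show ?thesis using out[of "Suc k"] by simp
  qed
  obtain nu where nu: "is_partition nu" "length nu \<le> N" "\<And>i. part nu i = Poly_Mapping.lookup mu i"
    by (rule partition_of_decreasing[of "Poly_Mapping.lookup mu" N]) (use out dec in auto)
  have "(\<Sum>m\<in>alt_monomials nu w. g m) = 0" if w: "w permutes {1..N}" "w \<noteq> id" for w
  proof (rule sum.neutral, rule ballI, rule ccontr)
    fix m' assume m': "m' \<in> alt_monomials nu w" "g m' \<noteq> 0"
    have "Poly_Mapping.lookup m' i = 0" if "i \<notin> {1..N}" for i
    proof -
      have "Poly_Mapping.lookup m' i + w i = part nu (w i) + i" using m'(1) unfolding alt_monomials_def by blast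
      then show ?thesis using permutes_not_in[OF w(1) that] nu(3) out[OF that] by simp
    qed
    then have "Poly_Mapping.keys m' \<subseteq> {1..N}" by (metis in_keys_iff subsetI)
    then have "sq m' \<le> sq mu" using m'(2) by (intro sq_max) (simp add: S_def)
    then show False using permuted_sum_squares[OF nu(1) w m'(1)] by (simp add: sq_def nu(3))
  qed
  then have "alt_coeff N nu g = (\<Sum>w | w permutes {1..N}. if w = id then (\<Sum>m\<in>alt_monomials nu id. g m) else 0)"
    unfolding alt_coeff_def by (intro sum.cong) auto
  also have "\<dots> = (\<Sum>m\<in>alt_monomials nu id. g m)"
    using finite_permutations[of "{1..N}"] permutes_id[of "{1..N}"] by (simp add: sum.delta)
  also have "alt_monomials nu id = {mu}"
    by (rule alt_monomials_subsingleton) (simp add: alt_monomials_def nu(3))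
  finally show False using alt[OF nu(1,2)] gmu by simp
qed

lemma skew_schur_nonzero:
  assumes "finite A" "skew_schur A m \<noteq> 0"
  shows "Poly_Mapping.lookup m 0 = 0" "Poly_Mapping.lookup m i \<le> card A"
proof -
  have "{T \<in> ssyt A. tableau_monomial A T = m} \<noteq> {}"
    using assms(2) unfolding skew_schur_def by (metis card.empty of_nat_0)
  then obtain T where T: "T \<in> ssyt A" "\<And>v. cnt A T v = Poly_Mapping.lookup m v"
    using tableau_monomial_eq_iff[OF assms(1)] by auto
  show "Poly_Mapping.lookup m i \<le> card A"
    unfolding T(2)[symmetric] cnt_def using assms(1) by (intro card_mono) auto
  have "0 \<notin> T ` A" using ssytD(3)[OF T(1)] by force
  then show "Poly_Mapping.lookup m 0 = 0" using cnt_pos_iff[OF assms(1), of T 0] by (simp add: T(2))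
qed

lemma LR_finite: "finite A \<Longrightarrow> finite (LR A nu)"
  by (rule finite_subset[OF _ finite_ssyt_content[of A "part nu"]]) (auto simp: LR_def)

lemma LR_partition_bounds:
  assumes "finite A" "is_partition nu" "LR A nu \<noteq> {}"
  shows "set nu \<subseteq> {..card A}" "length nu \<le> card A"
proof -
  obtain T where T: "\<And>v. cnt A T v = part nu v" using assms(3) unfolding LR_def by blast
  have "cnt A T v \<le> card A" for v unfolding cnt_def using assms(1) by (intro card_mono) auto
  then have le: "part nu v \<le> card A" for v using T by metis
  have "nu ! i \<le> card A" if "i < length nu" for i
    using le[of "Suc i"] that by (simp add: part_def)
  then show "set nu \<subseteq> {..card A}" by (auto simp: in_set_conv_nth)
  have "{1..length nu} \<subseteq> T ` A"
  proof
    fix v assume "v \<in> {1..length nu}"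
    then have "part nu v \<in> set nu" by (auto simp: part_def)
    then have "part nu v \<noteq> 0" using assms(2) unfolding is_partition_def by metis
    then show "v \<in> T ` A" using cnt_pos_iff[OF assms(1), of T v] T[of v] by simp
  qed
  then have "card {1..length nu} \<le> card (T ` A)" using assms(1) by (intro card_mono) auto
  then show "length nu \<le> card A" using card_image_le[OF assms(1), of T] by simp
qed

text \<open>The candidate coefficients are the numbers of lattice fillings. The difference
  \<open>g\<close> of the two sides is symmetric, has bounded exponents and is killed by every
  \<open>alt_coeff\<close>, hence vanishes.\<close>

lemma skew_schur_expansion_exists:
  assumes A: "convex_shape A"
  shows "\<exists>c. is_schur_expansion (skew_schur A) c"
proof -
  note fin = convex_shapeD(1)[OF A]
  define P where "P = {nu. is_partition nu \<and> set nu \<subseteq> {..card A} \<and> length nu \<le> card A}"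
  have finP: "finite P"
    by (rule finite_subset[OF _ finite_lists_length_le[of "{..card A}" "card A"]]) (auto simp: P_def)
  define a where "a nu = (if is_partition nu then int (card (LR A nu)) else 0)" for nu
  have aP: "a nu = 0" if "nu \<notin> P" for nu
    using LR_partition_bounds[OF fin, of nu] that unfolding a_def P_def by (cases "LR A nu = {}") auto
  then have fina: "finite {nu. a nu \<noteq> 0}" by (intro finite_subset[OF _ finP]) blast
  define c where "c = Abs_poly_mapping a"
  have c: "Poly_Mapping.lookup c = a" unfolding c_def using fina by simp
  have keysP: "Poly_Mapping.keys c \<subseteq> P" using aP c by (metis in_keys_iff subsetI)
  define g where "g m = skew_schur A m - (\<Sum>nu\<in>P. a nu * schur nu m)" for m
  have conv: "convex_shape (diagram nu)" if "nu \<in> P" for nu using that diagram_convex unfolding P_def by blast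
  define n where "n = card A + (\<Sum>nu\<in>P. card (diagram nu))"
  have nz: "Poly_Mapping.lookup m 0 = 0 \<and> Poly_Mapping.lookup m i \<le> n" if "g m \<noteq> 0" for m i
  proof (cases "skew_schur A m = 0")
    case True
    then have "(\<Sum>nu\<in>P. a nu * schur nu m) \<noteq> 0" using that unfolding g_def by simp
    then obtain nu where nu: "nu \<in> P" "a nu * schur nu m \<noteq> 0" by (rule sum.not_neutral_contains_not_neutral)
    have "card (diagram nu) \<le> n" unfolding n_def using member_le_sum[OF nu(1), of "\<lambda>nu. card (diagram nu)"] finP by simp
    then show ?thesis using skew_schur_nonzero(1)[OF finite_diagram, of nu m] skew_schur_nonzero(2)[OF finite_diagram, of nu m i] nu(2)
      unfolding schur_def by auto
  next
    case False
    then show ?thesis using skew_schur_nonzero(1)[OF fin False] skew_schur_nonzero(2)[OF fin False, of i] unfolding n_def by simp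
  qed
  have "g m = 0" for m
  proof (rule symmetric_eq_0)
    show "g (Poly_Mapping.map_key (transpose k (Suc k)) m) = g m" if "1 \<le> k" for k m
      unfolding g_def schur_def using skew_schur_symmetric[OF A that] skew_schur_symmetric[OF conv that] by simp
    show "Poly_Mapping.lookup m 0 = 0" if "g m \<noteq> 0" for m using nz[OF that] by blast
    show "Poly_Mapping.lookup m i \<le> n" if "g m \<noteq> 0" for m i using nz[OF that] by blast
    fix N nu assume nu: "is_partition nu" "length nu \<le> N"
    have "alt_coeff N nu g = a nu - (\<Sum>la\<in>P. a la * alt_coeff N nu (schur la))"
      using alt_coeff_skew_schur[OF A nu] nu(1) unfolding g_def alt_coeff_diff alt_coeff_sum a_def by simp
    also have "(\<Sum>la\<in>P. a la * alt_coeff N nu (schur la)) = (\<Sum>la\<in>P. if la = nu then a nu else 0)"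
      by (rule sum.cong) (auto simp: alt_coeff_schur nu P_def)
    also have "\<dots> = a nu" using aP[of nu] finP by (simp add: sum.delta)
    finally show "alt_coeff N nu g = 0" by simp
  qed
  then have "skew_schur A m = (\<Sum>nu\<in>P. a nu * schur nu m)" for m unfolding g_def by simp
  moreover have "(\<Sum>nu\<in>P. a nu * schur nu m) = (\<Sum>nu\<in>Poly_Mapping.keys c. a nu * schur nu m)" for m
    by (rule sum.mono_neutral_right[OF finP keysP]) (use c in \<open>auto simp: in_keys_iff\<close>)
  ultimately have "is_schur_expansion (skew_schur A) c"
    unfolding is_schur_expansion_def c using keysP by (auto simp: P_def)
  then show ?thesis by blast
qed

text \<open>Duality extracts the coefficient by a formula in \<open>f\<close> alone; this gives
  uniqueness.\<close>

lemma schur_expansion_coeff: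
  assumes "is_schur_expansion f c" "is_partition nu"
  shows "Poly_Mapping.lookup c nu = alt_coeff (length nu) nu f"
proof -
  have f: "f = (\<lambda>m. \<Sum>la\<in>Poly_Mapping.keys c. Poly_Mapping.lookup c la * schur la m)"
    and p: "\<And>la. la \<in> Poly_Mapping.keys c \<Longrightarrow> is_partition la"
    using assms(1) unfolding is_schur_expansion_def by auto
  have "alt_coeff (length nu) nu f =
      (\<Sum>la\<in>Poly_Mapping.keys c. Poly_Mapping.lookup c la * alt_coeff (length nu) nu (schur la))"
    by (subst f) (rule alt_coeff_sum)
  also have "\<dots> = (\<Sum>la\<in>Poly_Mapping.keys c. if la = nu then Poly_Mapping.lookup c nu else 0)"
    by (rule sum.cong) (auto simp: alt_coeff_schur p assms(2))
  also have "\<dots> = Poly_Mapping.lookup c nu" by (simp add: sum.delta in_keys_iff)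
  finally show ?thesis by simp
qed

lemma schur_expansion_unique:
  assumes "is_schur_expansion f c" "is_schur_expansion f c'"
  shows "c = c'"
proof (rule poly_mapping_eqI)
  fix nu
  show "Poly_Mapping.lookup c nu = Poly_Mapping.lookup c' nu"
  proof (cases "is_partition nu")
    case True
    then show ?thesis using assms schur_expansion_coeff by metis
  next
    case False
    then have "nu \<notin> Poly_Mapping.keys c" "nu \<notin> Poly_Mapping.keys c'"
      using assms unfolding is_schur_expansion_def by auto
    then show ?thesis by (simp add: in_keys_iff)
  qed
qed

theorem supp_eq_LR:
  assumes A: "convex_shape A"
  shows "supp A = {nu. is_partition nu \<and> LR A nu \<noteq> {}}"
proof -
  obtain c where c: "is_schur_expansion (skew_schur A) c" using skew_schur_expansion_exists[OF A] by blast
  then have "schur_expansion (skew_schur A) = c"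
    unfolding schur_expansion_def using schur_expansion_unique by (intro the_equality) auto
  moreover have "Poly_Mapping.lookup c nu = int (card (LR A nu))" if "is_partition nu" for nu
    using schur_expansion_coeff[OF c that] alt_coeff_skew_schur[OF A that order_refl] by simp
  ultimately show ?thesis unfolding supp_def using LR_finite[OF convex_shapeD(1)[OF A]] by auto
qed

subsection \<open>Row overlaps\<close>

lemma overlap_gt_0_bound:
  assumes A: "convex_shape A" and k: "1 \<le> k" and "overlap k A i \<noteq> 0"
  shows "i + k < num_rows A + 2"
proof -
  obtain x where "\<forall>t\<in>{i..<i + k}. (t, x) \<in> A"
    using assms(3) unfolding overlap_def by (metis (mono_tags, lifting) card.empty empty_Collect_eq)
  then have "(i + k - 1, x) \<in> A" using k by simp
  then have "i + k - 1 \<in> fst ` A" by force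
  then have "i + k - 1 \<le> num_rows A" unfolding num_rows_def using convex_shapeD(1)[OF A] by (intro Max_ge) auto
  then show ?thesis by simp
qed

text \<open>Sorting the row indices instead of the overlaps turns initial segments of
  \<open>rows k A\<close> into sums over sets of rows.\<close>

lemma rows_indices:
  assumes A: "convex_shape A" and k: "1 \<le> k"
  obtains js where "distinct js" "set js = {i. 1 \<le> i \<and> overlap k A i \<noteq> 0}" "rows k A = map (overlap k A) js"
proof -
  define xs where "xs = [1..<num_rows A + 2 - k]"
  define js where "js = filter (\<lambda>i. overlap k A i \<noteq> 0) (rev (sort_key (overlap k A) xs))"
  have "sort (map (overlap k A) xs) = map (overlap k A) (sort_key (overlap k A) xs)"
    by (rule properties_for_sort) simp_all
  then have "sort (filter (\<lambda>n. n \<noteq> 0) (map (overlap k A) xs)) =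
      map (overlap k A) (filter (\<lambda>i. overlap k A i \<noteq> 0) (sort_key (overlap k A) xs))"
    using filter_sort[of "\<lambda>n. n \<noteq> 0" "\<lambda>n. n" "map (overlap k A) xs"] by (simp only: filter_map comp_def)
  then have "rows k A = map (overlap k A) js" unfolding rows_def js_def xs_def by (simp add: rev_map rev_filter)
  moreover have "distinct js" unfolding js_def xs_def by simp
  moreover have "set js = {i. 1 \<le> i \<and> overlap k A i \<noteq> 0}"
    using overlap_gt_0_bound[OF A k] unfolding js_def xs_def by fastforce
  ultimately show ?thesis using that by blast
qed

lemma rows_sorted: "sorted_wrt (\<ge>) (rows k A)"
  unfolding rows_def by (simp add: sorted_wrt_rev)

lemma sum_lessThan_add:
  fixes f :: "nat \<Rightarrow> nat"
  shows "(\<Sum>m<a + b. f m) = (\<Sum>m<a. f m) + (\<Sum>m<b. f (a + m))"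
  by (induction b) (simp_all add: add.assoc)

lemma card_value_range:
  fixes h :: "'a \<Rightarrow> nat"
  assumes "finite A"
  shows "card {b \<in> A. x \<le> h b \<and> h b < x + d} = (\<Sum>m<d. card {b \<in> A. h b = x + m})"
proof (induction d)
  case 0
  have "{b \<in> A. x \<le> h b \<and> h b < x + 0} = {}" by auto
  then show ?case by (metis card.empty sum.empty lessThan_0)
next
  case (Suc d)
  have "{b \<in> A. x \<le> h b \<and> h b < x + Suc d} = {b \<in> A. x \<le> h b \<and> h b < x + d} \<union> {b \<in> A. h b = x + d}"
    by auto
  then show ?case using assms Suc by (subst \<open>_ = _ \<union> _\<close>, subst card_Un_disjoint) auto
qed

subsection \<open>Lattice fillings have large parts\<close>

context
  fixes A :: "(nat \<times> nat) set" and T :: "nat \<times> nat \<Rightarrow> nat"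
  assumes A: "convex_shape A" and T: "T \<in> ssyt A" "lattice_filling A T"
begin

lemma row_cnt_Suc: "row_cnt A T (Suc j) v = row_cnt A T j v + card {b \<in> A. fst b = Suc j \<and> T b = v}"
proof -
  have "{b \<in> A. fst b \<le> Suc j \<and> T b = v} = {b \<in> A. fst b \<le> j \<and> T b = v} \<union> {b \<in> A. fst b = Suc j \<and> T b = v}"
    by auto
  then show ?thesis
    unfolding row_cnt_def using convex_shapeD(1)[OF A] by (simp add: card_Un_disjoint disjoint_iff)
qed

text \<open>The \<open>v + 1\<close> in the first \<open>j + 1\<close> rows are at most as many as
  the \<open>v\<close> in the first \<open>j\<close> rows, that is, those in the first
  \<open>j + 1\<close> rows less those in row \<open>j + 1\<close>. Adding this up over
  \<open>v\<close> telescopes.\<close>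

lemma row_cnt_telescope:
  assumes "1 \<le> x"
  shows "(\<Sum>m<d. card {b \<in> A. fst b = Suc j \<and> T b = x + m}) + row_cnt A T (Suc j) (x + d) \<le> row_cnt A T (Suc j) x"
proof (induction d)
  case (Suc d)
  have "row_cnt A T (Suc j) (Suc (x + d)) \<le> row_cnt A T j (x + d)"
    by (rule row_cnt_lattice[OF A T]) (use assms in simp)
  then show ?case using Suc row_cnt_Suc[of j "x + d"] by simp
qed simp

text \<open>The entries \<open>k\<close> to \<open>k + l - 1\<close> of row \<open>j + 1\<close> are
  the growth of the first \<open>l\<close> counts; those from \<open>k + l\<close> on are bounded by
  the one additional count, by telescoping.\<close>

lemma row_tail_bound:
  assumes "1 \<le> k"
  shows "card {b \<in> A. fst b = Suc j \<and> k \<le> T b} + (\<Sum>m<l. row_cnt A T j (k + m)) \<le> (\<Sum>m<Suc l. row_cnt A T (Suc j) (k + m))"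
proof -
  let ?r = "\<lambda>v. card {b \<in> A. fst b = Suc j \<and> T b = v}"
  note fin = convex_shapeD(1)[OF A]
  \<comment> \<open>Exceeds every entry, so cutting the values off below \<open>k + (l + d)\<close>
    loses nothing.\<close>
  define d where "d = Suc (Max (insert 0 (T ` A)))"
  have d: "T b < d" if "b \<in> A" for b unfolding d_def using fin that by (auto simp: less_Suc_eq_le intro!: Max_ge)
  have "{b \<in> A. fst b = Suc j \<and> k \<le> T b} = {b \<in> {b \<in> A. fst b = Suc j}. k \<le> T b \<and> T b < k + (l + d)}"
    using d by (auto simp: trans_less_add2)
  then have "card {b \<in> A. fst b = Suc j \<and> k \<le> T b} = (\<Sum>m<l + d. ?r (k + m))"
    using card_value_range[of "{b \<in> A. fst b = Suc j}" k T "l + d"] fin by simp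
  also have "\<dots> = (\<Sum>m<l. ?r (k + m)) + (\<Sum>m<d. ?r (k + l + m))"
    unfolding sum_lessThan_add by (simp add: add.assoc)
  also have "(\<Sum>m<d. ?r (k + l + m)) \<le> row_cnt A T (Suc j) (k + l)"
    using row_cnt_telescope[of "k + l" j d] assms by simp
  finally show ?thesis by (simp add: row_cnt_Suc sum.distrib)
qed

text \<open>Induction on the rows: a row in \<open>J\<close> adds one more value to the bound, a row
  outside \<open>J\<close> only lets the counts grow.\<close>

lemma rows_tail_bound:
  assumes "1 \<le> k" "J \<subseteq> {1..j}"
  shows "(\<Sum>i\<in>J. card {b \<in> A. fst b = i \<and> k \<le> T b}) \<le> (\<Sum>m<card J. row_cnt A T j (k + m))"
  using assms(2)
proof (induction j arbitrary: J)
  case 0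
  then show ?case by simp
next
  case (Suc j)
  have finJ: "finite J" using Suc.prems by (rule finite_subset) simp
  show ?case
  proof (cases "Suc j \<in> J")
    case True
    define J' where "J' = J - {Suc j}"
    have J': "J = insert (Suc j) J'" "Suc j \<notin> J'" "finite J'" using True finJ by (auto simp: J'_def)
    have "J' \<subseteq> {1..j}" using Suc.prems by (auto simp: J'_def le_Suc_eq)
    then show ?thesis using Suc.IH[of J'] row_tail_bound[OF assms(1), of j "card J'"] J' by simp
  next
    case False
    then have "J \<subseteq> {1..j}" using Suc.prems by (auto simp: le_Suc_eq)
    then have "(\<Sum>i\<in>J. card {b \<in> A. fst b = i \<and> k \<le> T b}) \<le> (\<Sum>m<card J. row_cnt A T j (k + m))"
      by (rule Suc.IH)
    also have "\<dots> \<le> (\<Sum>m<card J. row_cnt A T (Suc j) (k + m))" by (rule sum_mono) (simp add: row_cnt_Suc)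
    finally show ?thesis .
  qed
qed

text \<open>A box in the \<open>k\<close> rows' common columns has \<open>k - 1\<close> boxes above it, so its entry is at least \<open>k\<close>.\<close>

lemma overlap_le_tail:
  assumes k: "1 \<le> k" and i: "1 \<le> i"
  shows "overlap k A i \<le> card {b \<in> A. fst b = i + k - 1 \<and> k \<le> T b}"
  unfolding overlap_def
proof (rule card_inj_on_le[of "\<lambda>x. (i + k - 1, x)"])
  show "(\<lambda>x. (i + k - 1, x)) ` {x. \<forall>t\<in>{i..<i + k}. (t, x) \<in> A} \<subseteq> {b \<in> A. fst b = i + k - 1 \<and> k \<le> T b}"
  proof
    fix b assume "b \<in> (\<lambda>x. (i + k - 1, x)) ` {x. \<forall>t\<in>{i..<i + k}. (t, x) \<in> A}"
    then obtain x where x: "b = (i + k - 1, x)" "\<forall>t\<in>{i..<i + k}. (t, x) \<in> A" by auto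
    have b: "(i, x) \<in> A" "(i + k - 1, x) \<in> A" using x(2) k by simp_all
    have "T (i, x) + (i + k - 1 - i) \<le> T (i + k - 1, x)"
      by (rule ssyt_weak_mono[OF A T(1) b]) (use k in auto)
    moreover have "1 \<le> T (i, x)" using ssytD(3)[OF T(1) b(1)] .
    ultimately show "b \<in> {b \<in> A. fst b = i + k - 1 \<and> k \<le> T b}" using b x(1) k by simp
  qed
qed (use convex_shapeD(1)[OF A] in \<open>auto simp: inj_on_def\<close>)

lemma overlap_sum_le_cnt:
  assumes k: "1 \<le> k" and J: "finite J" "J \<subseteq> {1..}"
  shows "(\<Sum>i\<in>J. overlap k A i) \<le> (\<Sum>m<card J. cnt A T (k + m))"
proof -
  \<comment> \<open>Each overlap is charged to the last of its \<open>k\<close> rows, a different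
    one for each \<open>i\<close>.\<close>
  define f where "f i = i + k - 1" for i
  have inj: "inj_on f J" using k by (auto simp: inj_on_def f_def)
  define j where "j = Max (insert 0 (f ` J))"
  have j: "f ` J \<subseteq> {1..j}"
  proof
    fix x assume x: "x \<in> f ` J"
    then have "1 \<le> x" using J(2) k by (auto simp: f_def)
    moreover have "x \<le> j" unfolding j_def using J(1) x by (intro Max_ge) auto
    ultimately show "x \<in> {1..j}" by simp
  qed
  have "(\<Sum>i\<in>J. overlap k A i) \<le> (\<Sum>i\<in>J. card {b \<in> A. fst b = f i \<and> k \<le> T b})"
    by (rule sum_mono) (use overlap_le_tail[OF k] J(2) in \<open>auto simp: f_def\<close>)
  also have "\<dots> = (\<Sum>i\<in>f ` J. card {b \<in> A. fst b = i \<and> k \<le> T b})"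
    unfolding sum.reindex[OF inj] comp_def ..
  also have "\<dots> \<le> (\<Sum>m<card (f ` J). row_cnt A T j (k + m))" by (rule rows_tail_bound[OF k j])
  also have "card (f ` J) = card J" by (rule card_image[OF inj])
  also have "(\<Sum>m<card J. row_cnt A T j (k + m)) \<le> (\<Sum>m<card J. cnt A T (k + m))"
    unfolding row_cnt_def cnt_def using convex_shapeD(1)[OF A] by (intro sum_mono card_mono) auto
  finally show ?thesis .
qed

lemma take_rows_le_cnt:
  assumes k: "1 \<le> k"
  shows "sum_list (take l (rows k A)) \<le> (\<Sum>m<l. cnt A T (k + m))"
proof -
  obtain js where js: "distinct js" "set js = {i. 1 \<le> i \<and> overlap k A i \<noteq> 0}" "rows k A = map (overlap k A) js"
    using rows_indices[OF A k] .
  define J where "J = set (take l js)"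
  have d: "distinct (take l js)" using js(1) by simp
  have "sum_list (take l (rows k A)) = (\<Sum>i\<in>J. overlap k A i)"
    unfolding js(3) take_map J_def using d by (simp add: sum_list_distinct_conv_sum_set)
  also have "\<dots> \<le> (\<Sum>m<card J. cnt A T (k + m))"
    by (rule overlap_sum_le_cnt[OF k]) (use js(2) set_take_subset[of l js] in \<open>auto simp: J_def\<close>)
  also have "\<dots> \<le> (\<Sum>m<l. cnt A T (k + m))"
    by (rule sum_mono2) (use d in \<open>auto simp: J_def distinct_card\<close>)
  finally show ?thesis .
qed

end

subsection \<open>A lattice filling with small parts\<close>

definition row_len :: "(nat \<times> nat) set \<Rightarrow> nat \<Rightarrow> nat" where
  "row_len D i = card {x. (i, x) \<in> D}"

definition pos :: "(nat \<times> nat) set \<Rightarrow> nat \<times> nat \<Rightarrow> nat" where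
  "pos D b = card {x. snd b \<le> x \<and> (fst b, x) \<in> D}"

text \<open>The filling of \<open>D\<close> whose companion tableau is the key tableau of the sequence of row lengths:
  the box at position \<open>p\<close> from the right contains the number of rows of length at least \<open>p\<close> down to
  its own row.\<close>

definition key_val :: "(nat \<times> nat) set \<Rightarrow> nat \<times> nat \<Rightarrow> nat" where
  "key_val D b = card {i \<in> {1..fst b}. pos D b \<le> row_len D i}"

lemma ex_pos_in_set:
  fixes X :: "nat set"
  assumes "finite X" "1 \<le> p" "p \<le> card X"
  shows "\<exists>x\<in>X. card {y \<in> X. x \<le> y} = p"
  using assms
proof (induction "card X" arbitrary: X)
  case 0
  then show ?case by simp
next
  case (Suc n)
  show ?case
  proof (cases "p = card X")
    case True
    have X: "X \<noteq> {}" using Suc.prems by auto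
    have "{y \<in> X. Min X \<le> y} = X" using Suc.prems(1) by auto
    then show ?thesis using True Min_in[OF Suc.prems(1) X] by (intro bexI[of _ "Min X"]) simp
  next
    case False
    have X: "X \<noteq> {}" using Suc.prems by auto
    define X' where "X' = X - {Min X}"
    have "n = card X'" using Suc.hyps(2) Min_in[OF Suc.prems(1) X] Suc.prems(1) by (simp add: X'_def)
    then obtain x where x: "x \<in> X'" "card {y \<in> X'. x \<le> y} = p"
      using Suc.hyps(1)[of X'] Suc.prems False Suc.hyps(2) by (auto simp: X'_def)
    have "Min X < x" using x(1) Suc.prems(1) Min_le[of X x] unfolding X'_def by (auto simp: le_less)
    then have "{y \<in> X. x \<le> y} = {y \<in> X'. x \<le> y}" by (auto simp: X'_def)
    then show ?thesis using x by (intro bexI[of _ x]) (auto simp: X'_def)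
  qed
qed

context
  fixes D :: "(nat \<times> nat) set"
  assumes D: "convex_shape D"
begin

lemma finite_row: "finite {x. (i, x) \<in> D \<and> P x}" "finite {x. P x \<and> (i, x) \<in> D}" "finite {x. (i, x) \<in> D}"
proof -
  have "{x. (i, x) \<in> D} \<subseteq> snd ` D" by force
  then show "finite {x. (i, x) \<in> D}" using convex_shapeD(1)[OF D] by (meson finite_imageI finite_subset)
  then show "finite {x. (i, x) \<in> D \<and> P x}" "finite {x. P x \<and> (i, x) \<in> D}" by simp_all
qed

lemma pos_le_row_len: "pos D (i, x) \<le> row_len D i"
  unfolding pos_def row_len_def using finite_row by (intro card_mono) auto

lemma pos_ge_1: "b \<in> D \<Longrightarrow> 1 \<le> pos D b"
proof -
  assume "b \<in> D"
  then have "{x. snd b \<le> x \<and> (fst b, x) \<in> D} \<noteq> {}" by (auto intro: exI[of _ "snd b"])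
  then show ?thesis unfolding pos_def using finite_row(2)[of "\<lambda>x. snd b \<le> x" "fst b"] by (simp add: Suc_le_eq card_gt_0_iff)
qed

lemma pos_strict:
  assumes "(i, x) \<in> D" "x < x'"
  shows "pos D (i, x') < pos D (i, x)"
proof -
  have "x \<in> {y. x \<le> y \<and> (i, y) \<in> D} - {y. x' \<le> y \<and> (i, y) \<in> D}" using assms by simp
  moreover have "{y. x' \<le> y \<and> (i, y) \<in> D} \<subseteq> {y. x \<le> y \<and> (i, y) \<in> D}" using assms by auto
  ultimately have "{y. x' \<le> y \<and> (i, y) \<in> D} \<subset> {y. x \<le> y \<and> (i, y) \<in> D}" by blast
  then show ?thesis unfolding pos_def using finite_row(2) by (simp add: psubset_card_mono)
qed

lemma key_val_row_mono:
  assumes "x \<le> x'"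
  shows "key_val D (i, x) \<le> key_val D (i, x')"
proof -
  have "pos D (i, x') \<le> pos D (i, x)" unfolding pos_def using finite_row assms by (intro card_mono) auto
  then show ?thesis unfolding key_val_def by (intro card_mono) auto
qed

text \<open>Going down a column, the position from the right can only drop, by convexity. So every
  row counted before is still counted, and row \<open>i'\<close> is new.\<close>

lemma key_val_col_strict:
  assumes "(i, x) \<in> D" "(i', x) \<in> D" "i < i'"
  shows "key_val D (i, x) < key_val D (i', x)"
proof -
  have le: "pos D (i', x) \<le> pos D (i, x)" unfolding pos_def
  proof (rule card_mono)
    show "{y. snd (i', x) \<le> y \<and> (fst (i', x), y) \<in> D} \<subseteq> {y. snd (i, x) \<le> y \<and> (fst (i, x), y) \<in> D}"
      using convex_shapeD(4)[OF D assms(1), of i'] assms(3) by auto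
  qed (simp add: finite_row)
  have "{l \<in> {1..i}. pos D (i, x) \<le> row_len D l} \<subset> {l \<in> {1..i'}. pos D (i', x) \<le> row_len D l}"
  proof
    show "{l \<in> {1..i}. pos D (i, x) \<le> row_len D l} \<subseteq> {l \<in> {1..i'}. pos D (i', x) \<le> row_len D l}"
      using le assms(3) by auto
    have "i' \<in> {l \<in> {1..i'}. pos D (i', x) \<le> row_len D l}" "i' \<notin> {l \<in> {1..i}. pos D (i, x) \<le> row_len D l}"
      using assms(3) pos_le_row_len by auto
    then show "{l \<in> {1..i}. pos D (i, x) \<le> row_len D l} \<noteq> {l \<in> {1..i'}. pos D (i', x) \<le> row_len D l}" by blast
  qed
  then show ?thesis unfolding key_val_def by (intro psubset_card_mono) auto
qed

lemma key_val_ge_1: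
  assumes "b \<in> D" shows "1 \<le> key_val D b"
proof -
  have "fst b \<in> {i \<in> {1..fst b}. pos D b \<le> row_len D i}"
    using convex_shapeD(2)[OF D, of "fst b" "snd b"] pos_le_row_len[of "fst b" "snd b"] assms by simp
  then have "{i \<in> {1..fst b}. pos D b \<le> row_len D i} \<noteq> {}" by blast
  then show ?thesis unfolding key_val_def by (simp add: Suc_le_eq card_gt_0_iff del: Collect_empty_eq)
qed

text \<open>At a fixed position the key values number, from the top, the rows long enough to have
  that position.\<close>

lemma key_val_pos_inj:
  assumes "b \<in> D" "b' \<in> D" "key_val D b = key_val D b'" "pos D b = pos D b'"
  shows "b = b'"
proof -
  have lt: "key_val D b < key_val D b'" if "b' \<in> D" "pos D b = pos D b'" "fst b < fst b'" for b b'
  proof -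
    have "{l \<in> {1..fst b}. pos D b \<le> row_len D l} \<subset> {l \<in> {1..fst b'}. pos D b' \<le> row_len D l}"
    proof
      show "{l \<in> {1..fst b}. pos D b \<le> row_len D l} \<subseteq> {l \<in> {1..fst b'}. pos D b' \<le> row_len D l}"
        using that by auto
      have "fst b' \<in> {l \<in> {1..fst b'}. pos D b' \<le> row_len D l}" "fst b' \<notin> {l \<in> {1..fst b}. pos D b \<le> row_len D l}"
        using that pos_le_row_len[of "fst b'" "snd b'"] by auto
      then show "{l \<in> {1..fst b}. pos D b \<le> row_len D l} \<noteq> {l \<in> {1..fst b'}. pos D b' \<le> row_len D l}" by blast
    qed
    then show ?thesis unfolding key_val_def by (intro psubset_card_mono) auto
  qed
  have f: "fst b = fst b'" using lt[of b' b] lt[of b b'] assms by (metis nat_neq_iff)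
  have "snd b = snd b'"
  proof (rule ccontr)
    assume "snd b \<noteq> snd b'"
    then consider "snd b < snd b'" | "snd b' < snd b" by linarith
    then show False
      using pos_strict[of "fst b" "snd b" "snd b'"] pos_strict[of "fst b" "snd b'" "snd b"] assms f
      by cases (metis prod.collapse less_irrefl)+
  qed
  then show ?thesis using f by (simp add: prod_eq_iff)
qed

text \<open>Take the same position in the last earlier row that is long enough. Were this box
  strictly left of column \<open>x\<close>, convexity would put a box of its row above each box
  counted in row \<open>i\<close>, and the box itself would make one more, so the positions would
  differ.\<close>

lemma key_val_pred:
  assumes b: "(i, x) \<in> D" and v: "key_val D (i, x) = Suc v" "1 \<le> v"
  obtains b0 where "b0 \<in> D" "pos D b0 = pos D (i, x)" "key_val D b0 = v" "x \<le> snd b0"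
proof -
  define p where "p = pos D (i, x)"
  define X where "X i = {l \<in> {1..i}. p \<le> row_len D l}" for i
  have cX: "card (X i) = Suc v" using v(1) unfolding X_def p_def key_val_def by simp
  have "i \<in> X i" using convex_shapeD(2)[OF D b] pos_le_row_len unfolding X_def p_def by simp
  define X' where "X' = X i - {i}"
  have cX': "card X' = v" using cX \<open>i \<in> X i\<close> by (simp add: X'_def X_def)
  have finX': "finite X'" unfolding X'_def X_def by simp
  have neX': "X' \<noteq> {}" using cX' v(2) by auto
  define i0 where "i0 = Max X'"
  have i0: "i0 \<in> X'" unfolding i0_def using finX' neX' by (rule Max_in)
  then have i0': "1 \<le> i0" "i0 < i" "p \<le> row_len D i0" unfolding X'_def X_def by auto
  have "X i0 = X'"
  proof
    show "X i0 \<subseteq> X'" using i0' unfolding X'_def X_def by auto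
    show "X' \<subseteq> X i0"
    proof
      fix l assume l: "l \<in> X'"
      have "l \<le> i0" unfolding i0_def using finX' l by (rule Max_ge)
      then show "l \<in> X i0" using l unfolding X'_def X_def by auto
    qed
  qed
  obtain x0 where x0: "(i0, x0) \<in> D" "card {y \<in> {y. (i0, y) \<in> D}. x0 \<le> y} = p"
    using ex_pos_in_set[of "{y. (i0, y) \<in> D}" p] finite_row(3) i0'(3) pos_ge_1[OF b]
    unfolding row_len_def p_def by auto
  have "{y \<in> {y. (i0, y) \<in> D}. x0 \<le> y} = {y. snd (i0, x0) \<le> y \<and> (fst (i0, x0), y) \<in> D}" by auto
  then have pos0: "pos D (i0, x0) = p" using x0(2) unfolding pos_def by simp
  have val0: "key_val D (i0, x0) = v" unfolding key_val_def pos0 using \<open>X i0 = X'\<close> cX' by (simp add: X_def)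
  have "x \<le> x0"
  proof (rule ccontr)
    assume "\<not> x \<le> x0"
    then have lt: "x0 < x" by simp
    have "{y. snd (i, x) \<le> y \<and> (fst (i, x), y) \<in> D} \<subset> {y. snd (i0, x0) \<le> y \<and> (fst (i0, x0), y) \<in> D}"
    proof
      show "{y. snd (i, x) \<le> y \<and> (fst (i, x), y) \<in> D} \<subseteq> {y. snd (i0, x0) \<le> y \<and> (fst (i0, x0), y) \<in> D}"
        using convex_shapeD(4)[OF D x0(1), of i] lt i0'(2) by auto
      have "x0 \<in> {y. snd (i0, x0) \<le> y \<and> (fst (i0, x0), y) \<in> D}" "x0 \<notin> {y. snd (i, x) \<le> y \<and> (fst (i, x), y) \<in> D}"
        using x0(1) lt by auto
      then show "{y. snd (i, x) \<le> y \<and> (fst (i, x), y) \<in> D} \<noteq> {y. snd (i0, x0) \<le> y \<and> (fst (i0, x0), y) \<in> D}" by blast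
    qed
    then have "pos D (i, x) < pos D (i0, x0)" unfolding pos_def using finite_row(2) by (intro psubset_card_mono) auto
    then show False using pos0 p_def by simp
  qed
  then show ?thesis using that[of "(i0, x0)"] x0(1) pos0 val0 p_def by simp
qed

text \<open>Value and position embed the boxes in the diagram of the sorted row lengths: a value
  \<open>v\<close> at position \<open>p\<close> means that at least \<open>v\<close> rows have
  length at least \<open>p\<close>, so the \<open>v\<close>-th longest does. Values up to
  \<open>l\<close> land in its first \<open>l\<close> rows.\<close>

lemma card_key_val_le:
  assumes L: "sorted_wrt (\<ge>) (map (row_len D) js)" "distinct js" "set js = {i. 1 \<le> i \<and> row_len D i \<noteq> 0}"
  shows "card {b \<in> D. key_val D b \<le> l} \<le> sum_list (take l (map (row_len D) js))"
proof -
  define xs where "xs = map (row_len D) js"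
  have len: "length xs = length js" by (simp add: xs_def)
  have bound: "key_val D b \<le> length xs \<and> pos D b \<le> xs ! (key_val D b - 1)" if b: "b \<in> D" for b
  proof -
    note p1 = pos_ge_1[OF b] and v1 = key_val_ge_1[OF b]
    have "{i \<in> {1..fst b}. pos D b \<le> row_len D i} \<subseteq> (\<lambda>m. js ! m) ` {m. m < length xs \<and> pos D b \<le> xs ! m}"
    proof
      fix i assume i: "i \<in> {i \<in> {1..fst b}. pos D b \<le> row_len D i}"
      then have "i \<in> set js" using L(3) p1 by auto
      then obtain m where "m < length js" "js ! m = i" by (auto simp: in_set_conv_nth)
      then show "i \<in> (\<lambda>m. js ! m) ` {m. m < length xs \<and> pos D b \<le> xs ! m}"
        using i by (intro image_eqI[of _ _ m]) (auto simp: xs_def)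
    qed
    then have "key_val D b \<le> card ((\<lambda>m. js ! m) ` {m. m < length xs \<and> pos D b \<le> xs ! m})"
      unfolding key_val_def by (intro card_mono) auto
    also have "\<dots> \<le> card {m. m < length xs \<and> pos D b \<le> xs ! m}" by (rule card_image_le) simp
    finally have v: "key_val D b \<le> card {m. m < length xs \<and> pos D b \<le> xs ! m}" .
    also have "\<dots> \<le> card {..<length xs}" by (rule card_mono) auto
    finally have vl: "key_val D b \<le> length xs" by simp
    have "pos D b \<le> xs ! (key_val D b - 1)"
    proof (rule ccontr)
      assume n: "\<not> pos D b \<le> xs ! (key_val D b - 1)"
      have le: "xs ! m \<le> xs ! (key_val D b - 1)" if "m < length xs" "key_val D b - 1 \<le> m" for m
        using L(1) that unfolding xs_def[symmetric] sorted_wrt_iff_nth_less by (cases "m = key_val D b - 1") auto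
      have "m < key_val D b - 1" if "m < length xs" "pos D b \<le> xs ! m" for m
        using le[OF that(1)] that(2) n by (meson le_trans not_le)
      then have "{m. m < length xs \<and> pos D b \<le> xs ! m} \<subseteq> {..<key_val D b - 1}" by blast
      then have "card {m. m < length xs \<and> pos D b \<le> xs ! m} \<le> key_val D b - 1"
        by (metis card_lessThan card_mono finite_lessThan)
      then show False using v v1 by simp
    qed
    then show ?thesis using vl by simp
  qed
  let ?S = "SIGMA m:{..<length (take l xs)}. {1..xs ! m}"
  have "card {b \<in> D. key_val D b \<le> l} \<le> card ?S"
  proof (rule card_inj_on_le[of "\<lambda>b. (key_val D b - 1, pos D b)"])
    show "inj_on (\<lambda>b. (key_val D b - 1, pos D b)) {b \<in> D. key_val D b \<le> l}"
    proof (rule inj_onI)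
      fix b b' assume *: "b \<in> {b \<in> D. key_val D b \<le> l}" "b' \<in> {b \<in> D. key_val D b \<le> l}"
        "(key_val D b - 1, pos D b) = (key_val D b' - 1, pos D b')"
      then show "b = b'" using key_val_ge_1[of b] key_val_ge_1[of b'] by (intro key_val_pos_inj) auto
    qed
    show "(\<lambda>b. (key_val D b - 1, pos D b)) ` {b \<in> D. key_val D b \<le> l} \<subseteq> ?S"
    proof
      fix q assume "q \<in> (\<lambda>b. (key_val D b - 1, pos D b)) ` {b \<in> D. key_val D b \<le> l}"
      then obtain b where b: "b \<in> D" "key_val D b \<le> l" "q = (key_val D b - 1, pos D b)" by auto
      then show "q \<in> ?S" using bound[OF b(1)] pos_ge_1[OF b(1)] key_val_ge_1[OF b(1)] by auto
    qed
  qed auto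
  also have "\<dots> = (\<Sum>m<length (take l xs). xs ! m)" by simp
  also have "\<dots> = sum_list (take l xs)"
    unfolding sum_list_sum_nth atLeast0LessThan by (rule sum.cong) auto
  finally show ?thesis unfolding xs_def .
qed

end

section \<open>The layered filling\<close>

definition col_top :: "(nat \<times> nat) set \<Rightarrow> nat \<Rightarrow> nat" where
  "col_top B x = (LEAST t. (t, x) \<in> B)"

text \<open>Row \<open>i\<close> consists of the columns common to the \<open>k\<close> rows from
  \<open>i\<close> on, so the row lengths are the \<open>k\<close>-overlaps of
  \<open>B\<close>.\<close>

definition deep :: "nat \<Rightarrow> (nat \<times> nat) set \<Rightarrow> (nat \<times> nat) set" where
  "deep k B = {(i, x). 1 \<le> i \<and> (\<forall>t\<in>{i..<i + k}. (t, x) \<in> B)}"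

text \<open>The top \<open>k - 1\<close> boxes of each column contain \<open>1, 2, \<dots>\<close>; the others, moved up by \<open>k - 1\<close>, form
  \<open>deep k B\<close> and carry the key filling of that shape, raised by \<open>k - 1\<close>.\<close>

definition layered :: "nat \<Rightarrow> (nat \<times> nat) set \<Rightarrow> nat \<times> nat \<Rightarrow> nat" where
  "layered k B = restrict (\<lambda>(j, x). if Suc j < col_top B x + k then Suc j - col_top B x
     else k - 1 + key_val (deep k B) (Suc j - k, x)) B"

context
  fixes B :: "(nat \<times> nat) set" and k :: nat
  assumes B: "convex_shape B" and k: "1 \<le> k"
begin

lemma col_top:
  assumes "(j, x) \<in> B"
  shows "(col_top B x, x) \<in> B" "col_top B x \<le> j" "1 \<le> col_top B x"
proof -
  show *: "(col_top B x, x) \<in> B" unfolding col_top_def using assms by (rule LeastI)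
  show "col_top B x \<le> j" unfolding col_top_def using assms by (rule Least_le)
  show "1 \<le> col_top B x" using convex_shapeD(2)[OF B *] .
qed

lemma col_mem:
  assumes "(j, x) \<in> B" "col_top B x \<le> t" "t \<le> j"
  shows "(t, x) \<in> B"
  using convex_shapeD(4)[OF B col_top(1)[OF assms(1)] assms(1) assms(2,3)] by simp

lemma col_top_antimono:
  assumes "(j, x) \<in> B" "(j, x') \<in> B" "x \<le> x'"
  shows "col_top B x' \<le> col_top B x"
  by (rule col_top(2)) (use convex_shapeD(4)[OF B col_top(1)[OF assms(1)] assms(2)] col_top(2)[OF assms(1)] assms(3) in simp)

text \<open>The shape is an intersection of \<open>k\<close> vertical translates of
  \<open>B\<close>, so it inherits convexity and carries a key filling.\<close>

lemma deep_convex: "convex_shape (deep k B)"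
proof -
  have sub: "deep k B \<subseteq> B" using k by (auto simp: deep_def)
  have "(a, b) \<in> deep k B"
    if box: "(i, j) \<in> deep k B" "(i', j') \<in> deep k B" "i \<le> a" "a \<le> i'" "j \<le> b" "b \<le> j'" for i j i' j' a b
  proof -
    have "(t, b) \<in> B" if t: "t \<in> {a..<a + k}" for t
    proof -
      have "(i, j) \<in> B" using \<open>(i, j) \<in> deep k B\<close> sub by auto
      moreover have "(i' + k - 1, j') \<in> B" using \<open>(i', j') \<in> deep k B\<close> k by (auto simp: deep_def)
      ultimately show ?thesis by (rule convex_shapeD(4)[OF B]) (use t box in auto)
    qed
    then show ?thesis using box by (auto simp: deep_def)
  qed
  moreover have "finite (deep k B)" using sub convex_shapeD(1)[OF B] by (rule finite_subset)
  moreover have "1 \<le> i \<and> 1 \<le> j" if "(i, j) \<in> deep k B" for i j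
    using sub that convex_shapeD(2,3)[OF B] by blast
  ultimately show ?thesis unfolding convex_shape_def by blast
qed

lemma row_len_deep: "1 \<le> i \<Longrightarrow> row_len (deep k B) i = overlap k B i"
  by (simp add: row_len_def overlap_def deep_def)

text \<open>The box moves from row \<open>j\<close> to row \<open>j - (k - 1)\<close>, written
  \<open>Suc j - k\<close>, the first of the \<open>k\<close> rows ending in
  \<open>j\<close>.\<close>

lemma deepI:
  assumes "(j, x) \<in> B" "col_top B x + k \<le> Suc j"
  shows "(Suc j - k, x) \<in> deep k B"
  using col_top[OF assms(1)] assms(2) col_mem[OF assms(1)] by (auto simp: deep_def)

lemma deepD:
  assumes "(i, x) \<in> deep k B"
  shows "(i + k - 1, x) \<in> B" "col_top B x \<le> i" "1 \<le> i"
  using assms k col_top(2)[of i x] by (auto simp: deep_def)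

abbreviation (input) "S \<equiv> layered k B"

lemma layered_top: "(j, x) \<in> B \<Longrightarrow> Suc j < col_top B x + k \<Longrightarrow> S (j, x) = Suc j - col_top B x"
  by (simp add: layered_def)

lemma layered_deep: "(j, x) \<in> B \<Longrightarrow> col_top B x + k \<le> Suc j \<Longrightarrow> S (j, x) = k - 1 + key_val (deep k B) (Suc j - k, x)"
  by (simp add: layered_def)

lemma layered_deep_ge: "(j, x) \<in> B \<Longrightarrow> col_top B x + k \<le> Suc j \<Longrightarrow> k \<le> S (j, x)"
  using key_val_ge_1[OF deep_convex deepI] layered_deep[of j x] by fastforce

lemma layered_top_lt: "(j, x) \<in> B \<Longrightarrow> Suc j < col_top B x + k \<Longrightarrow> S (j, x) < k"
  using layered_top[of j x] k by simp

lemma layered_ssyt: "S \<in> ssyt B"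
proof -
  have pos: "1 \<le> S b" if b: "b \<in> B" for b
  proof (cases "Suc (fst b) < col_top B (snd b) + k")
    case True
    then show ?thesis using layered_top[of "fst b" "snd b"] col_top(2)[of "fst b" "snd b"] b by simp
  next
    case False
    then show ?thesis using layered_deep_ge[of "fst b" "snd b"] b k by simp
  qed
  have row: "S (j, x) \<le> S (j, x')" if A: "(j, x) \<in> B" "(j, x') \<in> B" and "x < x'" for j x x'
  proof -
    have top: "col_top B x' \<le> col_top B x" using col_top_antimono A \<open>x < x'\<close> by simp
    \<comment> \<open>Column tops weakly rise to the right, so a box right of a deep one is deep as
      well; the remaining fourth case cannot occur.\<close>
    consider "Suc j < col_top B x' + k" | "Suc j < col_top B x + k" "col_top B x' + k \<le> Suc j" | "col_top B x + k \<le> Suc j"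
      by linarith
    then show ?thesis
    proof cases
      case 1
      then show ?thesis using layered_top[OF A(1)] layered_top[OF A(2)] top by simp
    next
      case 2
      then show ?thesis using layered_top_lt[OF A(1)] layered_deep_ge[OF A(2)] by simp
    next
      case 3
      then show ?thesis using layered_deep[OF A(1)] layered_deep[OF A(2)] top key_val_row_mono[OF deep_convex, of x x'] \<open>x < x'\<close>
        by simp
    qed
  qed
  have col: "S (j, x) < S (j', x)" if A: "(j, x) \<in> B" "(j', x) \<in> B" and "j < j'" for j j' x
  proof -
    consider "Suc j' < col_top B x + k" | "Suc j < col_top B x + k" "col_top B x + k \<le> Suc j'" | "col_top B x + k \<le> Suc j"
      by linarith
    then show ?thesis
    proof cases
      case 1
      then show ?thesis using layered_top[OF A(1)] layered_top[OF A(2)] \<open>j < j'\<close> col_top(2)[OF A(1)] by simp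
    next
      case 2
      then show ?thesis using layered_top_lt[OF A(1)] layered_deep_ge[OF A(2)] by simp
    next
      case 3
      have "key_val (deep k B) (Suc j - k, x) < key_val (deep k B) (Suc j' - k, x)"
        by (rule key_val_col_strict[OF deep_convex deepI[OF A(1)] deepI[OF A(2)]]) (use 3 \<open>j < j'\<close> in auto)
      then show ?thesis using layered_deep[OF A(1)] layered_deep[OF A(2)] 3 \<open>j < j'\<close> by simp
    qed
  qed
  have "S \<in> B \<rightarrow>\<^sub>E {1..}"
  proof (rule PiE_I)
    show "S b \<in> {1..}" if "b \<in> B" for b using pos[OF that] by simp
    show "S b = undefined" if "b \<notin> B" for b using that by (simp add: layered_def)
  qed
  then show ?thesis unfolding ssyt_def using row col by blast
qed

text \<open>For \<open>v < k\<close> each \<open>v + 1\<close> is matched with the \<open>v\<close>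
  at the top of its own column, for \<open>v\<close> at least \<open>k\<close> with its predecessor
  in the key filling. The passage from \<open>k - 1\<close> to \<open>k\<close> between the two
  layers is of the first kind.\<close>

lemma layered_lattice: "lattice_filling B S"
proof -
  let ?D = "deep k B"
  have shift: "(i + k - 1, x) \<in> B \<and> S (i + k - 1, x) = k - 1 + key_val ?D (i, x)" if "(i, x) \<in> ?D" for i x
    using deepD[OF that] layered_deep[of "i + k - 1" x] k by simp
  have small: "\<exists>t. (t, x) \<in> B \<and> S (t, x) = v" if v: "1 \<le> v" "v < k" and b: "(j, x) \<in> B" "S (j, x) = Suc v" for v j x
  proof -
    have le: "col_top B x + v \<le> j"
    proof (cases "Suc j < col_top B x + k")
      case True
      then show ?thesis using layered_top[OF b(1)] b(2) by simp
    next
      case False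
      then show ?thesis using v by simp
    qed
    have t: "(col_top B x + v - 1, x) \<in> B" by (rule col_mem[OF b(1)]) (use le v in auto)
    show ?thesis using t layered_top[OF t] v by (intro exI[of _ "col_top B x + v - 1"]) auto
  qed
  \<comment> \<open>The position is recorded because value and position determine a box of
    \<open>deep k B\<close>; injectivity of the matching rests on this.\<close>
  have large: "\<exists>b0. b0 \<in> ?D \<and> pos ?D b0 = pos ?D (Suc j - k, x) \<and> k - 1 + key_val ?D b0 = v \<and> x \<le> snd b0 \<and> (Suc j - k, x) \<in> ?D"
    if v: "k \<le> v" and b: "(j, x) \<in> B" "S (j, x) = Suc v" for v j x
  proof -
    have le: "col_top B x + k \<le> Suc j" using layered_top_lt[OF b(1)] b(2) v by (cases "Suc j < col_top B x + k") auto
    have "key_val ?D (Suc j - k, x) = Suc (v - (k - 1))" using layered_deep[OF b(1) le] b(2) v k by simp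
    moreover have "1 \<le> v - (k - 1)" using v k by simp
    ultimately obtain b0 where "b0 \<in> ?D" "pos ?D b0 = pos ?D (Suc j - k, x)" "key_val ?D b0 = v - (k - 1)" "x \<le> snd b0"
      by (rule key_val_pred[OF deep_convex deepI[OF b(1) le]])
    then show ?thesis using deepI[OF b(1) le] v k by (intro exI[of _ b0]) auto
  qed
  define f where "f v b = (if v < k then (SOME t. (t, snd b) \<in> B \<and> S (t, snd b) = v, snd b)
     else let b0 = (SOME b0. b0 \<in> ?D \<and> pos ?D b0 = pos ?D (Suc (fst b) - k, snd b) \<and> k - 1 + key_val ?D b0 = v \<and>
         snd b \<le> snd b0 \<and> (Suc (fst b) - k, snd b) \<in> ?D) in (fst b0 + k - 1, snd b0))" for v :: nat and b :: "nat \<times> nat"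
  show ?thesis
  proof (rule lattice_fillingI[where f = f])
    show "finite B" using convex_shapeD(1)[OF B] .
    fix v :: nat assume v: "1 \<le> v"
    have fl: "\<exists>b0. f v b = (fst b0 + k - 1, snd b0) \<and> b0 \<in> ?D \<and> pos ?D b0 = pos ?D (Suc (fst b) - k, snd b) \<and> k - 1 + key_val ?D b0 = v \<and>
         snd b \<le> snd b0 \<and> (Suc (fst b) - k, snd b) \<in> ?D" if "k \<le> v" "b \<in> B" "S b = Suc v" for b
      using someI_ex[OF large[of v "fst b" "snd b"]] that unfolding f_def by (auto simp: Let_def)
    have fs: "f v b \<in> B \<and> S (f v b) = v \<and> snd (f v b) = snd b" if "v < k" "b \<in> B" "S b = Suc v" for b
      using someI_ex[OF small[of v "fst b" "snd b"]] that v unfolding f_def by auto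
    show "f v b \<in> B \<and> S (f v b) = v \<and> snd b \<le> snd (f v b)" if b: "b \<in> B" "S b = Suc v" for b
    proof (cases "v < k")
      case True
      then show ?thesis using fs[OF True b] by simp
    next
      case False
      then obtain b0 where b0: "f v b = (fst b0 + k - 1, snd b0)" "b0 \<in> ?D" "k - 1 + key_val ?D b0 = v" "snd b \<le> snd b0"
        using fl[of b] b by auto
      then show ?thesis using shift[of "fst b0" "snd b0"] by simp
    qed
    show "inj_on (f v) {b \<in> B. S b = Suc v}"
    proof (rule inj_onI)
      fix b b' assume b: "b \<in> {b \<in> B. S b = Suc v}" "b' \<in> {b \<in> B. S b = Suc v}" "f v b = f v b'"
      show "b = b'"
      proof (cases "v < k")
        case True
        then have snd: "snd b = snd b'" using fs[of b] fs[of b'] b by simp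
        have *: "(fst b', snd b) = b'" "(fst b, snd b) = b" using snd by (simp_all add: prod_eq_iff)
        have "fst b = fst b'"
          by (rule ssyt_column_inj[OF layered_ssyt, of _ "snd b"], unfold *) (use b in auto)
        then show ?thesis using snd by (simp add: prod_eq_iff)
      next
        case False
        let ?s = "\<lambda>b. (Suc (fst b) - k, snd b)"
        obtain b0 where b0: "f v b = (fst b0 + k - 1, snd b0)" "pos ?D b0 = pos ?D (?s b)" "?s b \<in> ?D"
          using fl[of b] b False by auto
        obtain b0' where b0': "f v b' = (fst b0' + k - 1, snd b0')" "pos ?D b0' = pos ?D (?s b')" "?s b' \<in> ?D"
          using fl[of b'] b False by auto
        have "b0 = b0'" using b(3) b0(1) b0'(1) k by (intro prod_eqI) auto
        then have pos: "pos ?D (?s b) = pos ?D (?s b')" using b0(2) b0'(2) by simp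
        have eq: "(Suc (fst b) - k) + k - 1 = fst b" if "?s b \<in> ?D" for b :: "nat \<times> nat"
          using deepD(3)[OF that] k by simp
        have "k - 1 + key_val ?D (?s b) = Suc v" "k - 1 + key_val ?D (?s b') = Suc v"
          using shift[OF b0(3)] shift[OF b0'(3)] eq[OF b0(3)] eq[OF b0'(3)] b by auto
        then have "?s b = ?s b'" using key_val_pos_inj[OF deep_convex b0(3) b0'(3) _ pos] by simp
        then have s: "Suc (fst b) - k = Suc (fst b') - k" "snd b = snd b'" by simp_all
        have "fst b = fst b'" using eq[OF b0(3)] eq[OF b0'(3)] unfolding s(1) by simp
        then show ?thesis using s(2) by (simp add: prod_eq_iff)
      qed
    qed
  qed
qed

text \<open>The values \<open>k\<close> to \<open>k + l - 1\<close> sit on deep boxes with key value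
  at most \<open>l\<close>, and the row lengths of the deep shape are the overlaps listed in
  \<open>rows k B\<close>.\<close>

lemma layered_cnt_le: "(\<Sum>m<l. cnt B S (k + m)) \<le> sum_list (take l (rows k B))"
proof -
  note fin = convex_shapeD(1)[OF B]
  have "(\<Sum>m<l. cnt B S (k + m)) = card {b \<in> B. k \<le> S b \<and> S b < k + l}"
    unfolding cnt_def using card_value_range[OF fin, of k S l] by simp
  also have "\<dots> \<le> card {b \<in> deep k B. key_val (deep k B) b \<le> l}"
  proof (rule card_inj_on_le[of "\<lambda>b. (Suc (fst b) - k, snd b)"])
    have d: "col_top B (snd b) + k \<le> Suc (fst b)" if "b \<in> {b \<in> B. k \<le> S b \<and> S b < k + l}" for b
      using layered_top_lt[of "fst b" "snd b"] that by (force simp: not_le[symmetric])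
    show "inj_on (\<lambda>b. (Suc (fst b) - k, snd b)) {b \<in> B. k \<le> S b \<and> S b < k + l}"
    proof (rule inj_onI)
      fix b b' assume *: "b \<in> {b \<in> B. k \<le> S b \<and> S b < k + l}" "b' \<in> {b \<in> B. k \<le> S b \<and> S b < k + l}"
        "(Suc (fst b) - k, snd b) = (Suc (fst b') - k, snd b')"
      then show "b = b'" using d[OF *(1)] d[OF *(2)] by (auto simp: prod_eq_iff)
    qed
    show "(\<lambda>b. (Suc (fst b) - k, snd b)) ` {b \<in> B. k \<le> S b \<and> S b < k + l} \<subseteq> {b \<in> deep k B. key_val (deep k B) b \<le> l}"
    proof
      fix q assume "q \<in> (\<lambda>b. (Suc (fst b) - k, snd b)) ` {b \<in> B. k \<le> S b \<and> S b < k + l}"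
      then obtain j x where b: "q = (Suc j - k, x)" "(j, x) \<in> B" "S (j, x) < k + l" "(j, x) \<in> {b \<in> B. k \<le> S b \<and> S b < k + l}"
        by auto
      have le: "col_top B x + k \<le> Suc j" using d[OF b(4)] by simp
      show "q \<in> {b \<in> deep k B. key_val (deep k B) b \<le> l}"
        using deepI[OF b(2) le] layered_deep[OF b(2) le] b(1,3) k by simp
    qed
    show "finite {b \<in> deep k B. key_val (deep k B) b \<le> l}" using convex_shapeD(1)[OF deep_convex] by simp
  qed
  also have "\<dots> \<le> sum_list (take l (rows k B))"
  proof -
    obtain js where js: "distinct js" "set js = {i. 1 \<le> i \<and> overlap k B i \<noteq> 0}" "rows k B = map (overlap k B) js"
      using rows_indices[OF B k] .
    have eq: "map (row_len (deep k B)) js = rows k B" unfolding js(3) using js(2) row_len_deep by (intro map_cong) auto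
    have "set js = {i. 1 \<le> i \<and> row_len (deep k B) i \<noteq> 0}" unfolding js(2) using row_len_deep by auto
    then show ?thesis using card_key_val_le[OF deep_convex _ js(1)] rows_sorted[of k B] unfolding eq[symmetric] by simp
  qed
  finally show ?thesis .
qed

lemma layered_in_LR:
  obtains nu where "is_partition nu" "S \<in> LR B nu"
proof -
  note fin = convex_shapeD(1)[OF B]
  have "0 \<notin> S ` B" using ssytD(3)[OF layered_ssyt] by force
  then have zero: "cnt B S 0 = 0" using cnt_pos_iff[OF fin, of S 0] by simp
  have dec: "cnt B S (Suc v) \<le> cnt B S v" if "1 \<le> v" for v
    using layered_lattice that unfolding lattice_filling_def cnt_eq_col_cnt by blast
  define N where "N = Max (insert 0 (S ` B))"
  have large: "cnt B S v = 0" if "N < v" for v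
  proof -
    have "v \<notin> S ` B" using that fin unfolding N_def by auto
    then show ?thesis using cnt_pos_iff[OF fin, of S v] by simp
  qed
  obtain nu where "is_partition nu" "\<forall>v. part nu v = cnt B S v"
  proof (rule partition_of_decreasing[of "cnt B S" N])
    show "cnt B S 0 = 0" by (rule zero)
    show "cnt B S (Suc v) \<le> cnt B S v" if "1 \<le> v" for v using that by (rule dec)
    show "cnt B S v = 0" if "N < v" for v using that by (rule large)
  qed blast
  then show ?thesis using that layered_ssyt layered_lattice unfolding LR_def by simp
qed

end

theorem theorem3p8:
  fixes A B :: "(nat \<times> nat) set"
  assumes "skew_shape A" and "skew_shape B"
    and "supp A \<supseteq> supp B"
  shows "\<forall>k\<ge>1. rows k A \<unlhd> rows k B"
proof (intro allI impI)
  fix k :: nat assume k: "k \<ge> 1"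
  note A = skew_shape_convex[OF assms(1)] and B = skew_shape_convex[OF assms(2)]
  \<comment> \<open>This \<open>nu\<close> depends on \<open>k\<close>, but it serves every
    \<open>l\<close>.\<close>
  obtain nu where nu: "is_partition nu" "layered k B \<in> LR B nu" using layered_in_LR[OF B k] .
  then have "nu \<in> supp A" using supp_eq_LR[OF B] assms(3) by blast
  then obtain T where T: "T \<in> ssyt A" "lattice_filling A T" "\<And>v. cnt A T v = part nu v"
    unfolding supp_eq_LR[OF A] LR_def by blast
  have "sum_list (take l (rows k A)) \<le> sum_list (take l (rows k B))" for l
  proof -
    have "sum_list (take l (rows k A)) \<le> (\<Sum>m<l. cnt A T (k + m))"
      by (rule take_rows_le_cnt[OF A T(1,2) k])
    also have "\<dots> = (\<Sum>m<l. cnt B (layered k B) (k + m))"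
      using nu(2) T(3) unfolding LR_def by simp
    also have "\<dots> \<le> sum_list (take l (rows k B))" by (rule layered_cnt_le[OF B k])
    finally show ?thesis .
  qed
  then show "rows k A \<unlhd> rows k B" unfolding dominated_def by blast
qed

end
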